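(* In the setting described in the context, with POD space $X=L^2(\Omega)$, there is a constant $C>0$, not depending on any discretization parameter (i.e. not on $V^h$, $N$, $\Delta t$ or $r$), such that the errors $e^k=u^k-u_r^k$, $k=1,\dots,N$, between the backward Euler finite element solution and the BE-POD-ROM solution satisfy $$\max_{1\le k\le N}\|\nabla e^k\|_{L^2}^2\le C\left(\sum_{i=r+1}^s\lambda_i^{DQ1}\Big(\|\varphi_i-R_r\varphi_i\|_{L^2}^2+\|\nabla(\varphi_i-R_r\varphi_i)\|_{L^2}^2\Big)+\|\phi_r^1\|_{H_0^1}^2\right).$$
   Context: All function spaces are real. $\Omega\subset\mathbb{R}^d$ ($d\ge1$) is an open bounded domain with Lipschitz continuous boundary, $V=H_0^1(\Omega)$ with inner product $(g,h)_{H_0^1}=(\nabla g,\nabla h)_{L^2}$, $\nu>0$ is a constant, $T>0$ is fixed, $N\ge2$, $\Delta t=T/(N-1)$, $t_n=(n-1)\Delta t$, and $f$ is a given forcing function, with $f^n=f(t_n)$. $V^h\subset V$ is a standard conforming (finite-dimensional) finite element space. Backward Euler finite element solution: $\{u^n\}_{n=1}^N\subset V^h$, with $u^1$ the given initial condition and, for $n=1,\dots,N-1$, $$\Big(\tfrac{u^{n+1}-u^n}{\Delta t},v\Big)_{L^2}+\nu(\nabla u^{n+1},\nabla v)_{L^2}=(f^{n+1},v)_{L^2}\quad\forall v\in V^h.$$ POD modes: write $\partial z^n=(z^{n+1}-z^n)/\Delta t$. Let $S=\mathbb{R}^N$ with inner product $(g,h)_S=g^1h^1+\Delta t\sum_{j=2}^Ng^jh^j$,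 and $K_1:S\to X$, $K_1f=f^1u^1+\sum_{j=1}^{N-1}\Delta t f^{j+1}\partial u^j$. Its singular value decomposition has singular values $(\lambda_i^{DQ1})^{1/2}$ (nonincreasing) and orthonormal singular vectors $f_i\in S$, $\varphi_i\in X$, with $K_1f_i=(\lambda_i^{DQ1})^{1/2}\varphi_i$. The $\varphi_i$ are the POD modes, the $\lambda_i^{DQ1}$ the POD eigenvalues, and $s$ is the number of positive POD eigenvalues. $r$ is a positive integer with $\varphi_1,\dots,\varphi_r\in V^h$, and $V_r^h=\mathrm{span}\{\varphi_j\}_{j=1}^r\subset V^h$. $\Pi_r^X:X\to X$ is the orthogonal projection onto $V_r^h$. BE-POD-ROM: $\{u_r^n\}_{n=1}^N\subset V_r^h$ with $u_r^1=\Pi_r^Xu^1$ and, for $n=1,\dots,N-1$, $$\Big(\tfrac{u_r^{n+1}-u_r^n}{\Delta t},v_r\Big)_{L^2}+\nu(\nabla u_r^{n+1},\nabla v_r)_{L^2}=(f^{n+1},v_r)_{L^2}\quad\forall v_r\in V_r^h.$$ The Ritz projection $R_r:V\to V_r^h$ is defined by $(\nabla(w-R_rw),\nabla v_r)_{L^2}=0$ for all $v_r\in V_r^h$. Finally $\phi_r^n=u_r^n-R_ru^n$ (distinct from the POD modes $\varphi_i$). *)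

theory Defs
  imports "HOL-Analysis.Analysis"
begin

definition sq_integrable :: "('a::euclidean_space \<Rightarrow> real) \<Rightarrow> bool" where
  "sq_integrable g \<longleftrightarrow> g \<in> borel_measurable lebesgue \<and> integrable lebesgue (\<lambda>x. (g x)\<^sup>2)"

lemma sq_integrable_mult:
  assumes "sq_integrable g" "sq_integrable h"
  shows "integrable lebesgue (\<lambda>x. g x * h x)"
proof (rule Bochner_Integration.integrable_bound)
  show "integrable lebesgue (\<lambda>x. (g x)\<^sup>2 + (h x)\<^sup>2)"
    using assms by (simp add: sq_integrable_def)
  show "(\<lambda>x. g x * h x) \<in> borel_measurable lebesgue"
    using assms by (auto simp: sq_integrable_def)
  have "\<bar>a * b\<bar> \<le> a\<^sup>2 + b\<^sup>2" for a b :: real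
  proof -
    have "0 \<le> (\<bar>a\<bar> - \<bar>b\<bar>)\<^sup>2" "0 \<le> \<bar>a\<bar> * \<bar>b\<bar>" by auto
    then show ?thesis unfolding power2_diff abs_mult power2_abs by linarith
  qed
  then show "AE x in lebesgue. norm (g x * h x) \<le> norm ((g x)\<^sup>2 + (h x)\<^sup>2)"
    by simp
qed

lemma sq_integrable_zero: "sq_integrable (\<lambda>x. 0)"
  by (simp add: sq_integrable_def)

lemma sq_integrable_add:
  assumes "sq_integrable g" "sq_integrable h"
  shows "sq_integrable (\<lambda>x. g x + h x)"
  unfolding sq_integrable_def
proof
  show "(\<lambda>x. g x + h x) \<in> borel_measurable lebesgue"
    using assms by (auto simp: sq_integrable_def)
  have "integrable lebesgue (\<lambda>x. (g x)\<^sup>2 + (h x)\<^sup>2 + 2 * (g x * h x))"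
    using assms sq_integrable_mult[OF assms] by (simp add: sq_integrable_def)
  then show "integrable lebesgue (\<lambda>x. (g x + h x)\<^sup>2)"
    by (simp add: power2_sum mult.assoc)
qed

lemma sq_integrable_scale:
  assumes "sq_integrable g"
  shows "sq_integrable (\<lambda>x. c * g x)"
  using assms by (auto simp: sq_integrable_def power_mult_distrib)

lemma sq_integrable_minus: "sq_integrable g \<Longrightarrow> sq_integrable (\<lambda>x. - g x)"
  using sq_integrable_scale[of g "-1"] by simp

lemma sq_integrable_diff:
  "sq_integrable g \<Longrightarrow> sq_integrable h \<Longrightarrow> sq_integrable (\<lambda>x. g x - h x)"
  using sq_integrable_add[of g "\<lambda>x. - h x"] sq_integrable_minus[of h] by simp

quotient_type (overloaded) 'a L2 = "'a::euclidean_space \<Rightarrow> real" / partial: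
  "\<lambda>g h. sq_integrable g \<and> sq_integrable h \<and> (AE x in lebesgue. g x = h x)"
  morphisms rep_L2 abs_L2
proof (rule part_equivpI)
  show "\<exists>g::'a \<Rightarrow> real. sq_integrable g \<and> sq_integrable g \<and> (AE x in lebesgue. g x = g x)"
    using sq_integrable_zero by auto
  show "symp (\<lambda>g h::'a \<Rightarrow> real. sq_integrable g \<and> sq_integrable h \<and> (AE x in lebesgue. g x = h x))"
    by (auto simp: symp_def elim: eventually_mono)
  show "transp (\<lambda>g h::'a \<Rightarrow> real. sq_integrable g \<and> sq_integrable h \<and> (AE x in lebesgue. g x = h x))"
    by (auto simp: transp_def elim: eventually_elim2)
qed

instantiation L2 :: (euclidean_space) real_vector
begin

lift_definition zero_L2 :: "'a L2" is "\<lambda>x. 0"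
  by (simp add: sq_integrable_zero)

lift_definition plus_L2 :: "'a L2 \<Rightarrow> 'a L2 \<Rightarrow> 'a L2" is "\<lambda>g h x. g x + h x"
  by (auto intro: sq_integrable_add elim: eventually_elim2)

lift_definition minus_L2 :: "'a L2 \<Rightarrow> 'a L2 \<Rightarrow> 'a L2" is "\<lambda>g h x. g x - h x"
  by (auto intro: sq_integrable_diff elim: eventually_elim2)

lift_definition uminus_L2 :: "'a L2 \<Rightarrow> 'a L2" is "\<lambda>g x. - g x"
  by (auto intro: sq_integrable_minus elim: eventually_mono)

lift_definition scaleR_L2 :: "real \<Rightarrow> 'a L2 \<Rightarrow> 'a L2" is "\<lambda>c g x. c * g x"
  by (auto intro: sq_integrable_scale elim: eventually_mono)

instance
  by standard
    (transfer; auto simp: algebra_simps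
      intro!: sq_integrable_add sq_integrable_minus sq_integrable_diff sq_integrable_scale
        sq_integrable_zero)+

end

instantiation L2 :: (euclidean_space) real_inner
begin

lift_definition inner_L2 :: "'a L2 \<Rightarrow> 'a L2 \<Rightarrow> real" is "\<lambda>g h. \<integral>x. g x * h x \<partial>lebesgue"
proof -
  fix g g' h h' :: "'a \<Rightarrow> real"
  assume g: "sq_integrable g \<and> sq_integrable g' \<and> (AE x in lebesgue. g x = g' x)"
    and h: "sq_integrable h \<and> sq_integrable h' \<and> (AE x in lebesgue. h x = h' x)"
  show "(\<integral>x. g x * h x \<partial>lebesgue) = (\<integral>x. g' x * h' x \<partial>lebesgue)"
  proof (rule integral_cong_AE)
    show "(\<lambda>x. g x * h x) \<in> borel_measurable lebesgue"
      "(\<lambda>x. g' x * h' x) \<in> borel_measurable lebesgue"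
      using g h by (auto simp: sq_integrable_def)
    show "AE x in lebesgue. g x * h x = g' x * h' x"
      using g h by (auto elim: eventually_elim2)
  qed
qed

definition "norm (g::'a L2) = sqrt (g \<bullet> g)"
definition "dist (g::'a L2) h = norm (g - h)"
definition "sgn (g::'a L2) = g /\<^sub>R norm g"
definition "uniformity = (INF e\<in>{0 <..}. principal {(g::'a L2, h). dist g h < e})"
definition "open (U::'a L2 set) \<longleftrightarrow> (\<forall>g\<in>U. \<forall>\<^sub>F (g', h) in uniformity. g' = g \<longrightarrow> h \<in> U)"

instance
proof
  fix g h k :: "'a L2" and c :: real
  show "g \<bullet> h = h \<bullet> g"
    by transfer (simp add: mult.commute)
  show "(g + h) \<bullet> k = g \<bullet> k + h \<bullet> k"
    by transfer (simp add: distrib_right sq_integrable_mult)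
  show "(c *\<^sub>R g) \<bullet> h = c * (g \<bullet> h)"
    by transfer (simp add: mult.assoc)
  show "0 \<le> g \<bullet> g"
    by transfer simp
  show "(g \<bullet> g = 0) = (g = 0)"
  proof transfer
    fix g :: "'a \<Rightarrow> real"
    assume g: "sq_integrable g \<and> sq_integrable g \<and> (AE x in lebesgue. g x = g x)"
    have "((\<integral>x. g x * g x \<partial>lebesgue) = 0) = (AE x in lebesgue. g x * g x = 0)"
      using g sq_integrable_mult[of g g] by (intro integral_nonneg_eq_0_iff_AE) auto
    then show "((\<integral>x. g x * g x \<partial>lebesgue) = 0) =
        (sq_integrable g \<and> sq_integrable (\<lambda>x. 0) \<and> (AE x in lebesgue. g x = 0))"
      using g by (simp add: sq_integrable_zero)
  qed
qed (fact norm_L2_def dist_L2_def sgn_L2_def uniformity_L2_def open_L2_def)+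

end

text \<open>
  \<open>L\<^sup>2(\<Omega>)\<close> is identified, through extension by zero, with the subspace of those elements of
  \<open>L\<^sup>2\<close> of the whole space that vanish almost everywhere outside \<open>\<Omega>\<close>; the
  \<open>L\<^sup>2(\<Omega>)\<close> inner product is then \<^term>\<open>inner\<close>.
\<close>

lift_definition vanishes_outside :: "'a::euclidean_space set \<Rightarrow> 'a L2 \<Rightarrow> bool" is
  "\<lambda>\<Omega> g. AE x in lebesgue. x \<notin> \<Omega> \<longrightarrow> g x = 0"
  by (auto elim: eventually_elim2)

definition L2_on :: "'a::euclidean_space set \<Rightarrow> 'a L2 set" where
  "L2_on \<Omega> = {g. vanishes_outside \<Omega> g}"

definition partial_deriv ::
    "'a::euclidean_space \<Rightarrow> ('a \<Rightarrow> real) \<Rightarrow> 'a \<Rightarrow> real" where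
  "partial_deriv b \<psi> x = frechet_derivative \<psi> (at x) b"

definition smooth_fun :: "('a::euclidean_space \<Rightarrow> real) \<Rightarrow> bool" where
  "smooth_fun \<psi> \<longleftrightarrow>
     (\<forall>bs. set bs \<subseteq> Basis \<longrightarrow> fold partial_deriv bs \<psi> differentiable_on UNIV)"

definition test_fun :: "'a::euclidean_space set \<Rightarrow> ('a \<Rightarrow> real) \<Rightarrow> bool" where
  "test_fun \<Omega> \<psi> \<longleftrightarrow>
     smooth_fun \<psi> \<and> (\<exists>K. compact K \<and> K \<subseteq> \<Omega> \<and> (\<forall>x. x \<notin> K \<longrightarrow> \<psi> x = 0))"

definition is_weak_deriv ::
    "'a::euclidean_space set \<Rightarrow> 'a \<Rightarrow> 'a L2 \<Rightarrow> 'a L2 \<Rightarrow> bool" where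
  "is_weak_deriv \<Omega> b g G \<longleftrightarrow> G \<in> L2_on \<Omega> \<and>
     (\<forall>\<psi>. test_fun \<Omega> \<psi> \<longrightarrow>
        inner g (abs_L2 (partial_deriv b \<psi>)) = - inner G (abs_L2 \<psi>))"

definition weak_deriv :: "'a::euclidean_space set \<Rightarrow> 'a \<Rightarrow> 'a L2 \<Rightarrow> 'a L2" where
  "weak_deriv \<Omega> b g = (THE G. is_weak_deriv \<Omega> b g G)"

definition H1 :: "'a::euclidean_space set \<Rightarrow> 'a L2 set" where
  "H1 \<Omega> = {g \<in> L2_on \<Omega>. \<forall>b\<in>Basis. \<exists>G. is_weak_deriv \<Omega> b g G}"

definition grad_inner :: "'a::euclidean_space set \<Rightarrow> 'a L2 \<Rightarrow> 'a L2 \<Rightarrow> real" where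
  "grad_inner \<Omega> g h = (\<Sum>b\<in>Basis. inner (weak_deriv \<Omega> b g) (weak_deriv \<Omega> b h))"

definition grad_norm :: "'a::euclidean_space set \<Rightarrow> 'a L2 \<Rightarrow> real" where
  "grad_norm \<Omega> g = sqrt (grad_inner \<Omega> g g)"

definition H1_norm :: "'a::euclidean_space set \<Rightarrow> 'a L2 \<Rightarrow> real" where
  "H1_norm \<Omega> g = sqrt ((norm g)\<^sup>2 + (grad_norm \<Omega> g)\<^sup>2)"

text \<open>The closure of the test functions in \<open>H\<^sup>1(\<Omega>)\<close>. The inner product and norm of
  \<open>H\<^sup>1\<^sub>0(\<Omega>)\<close> are \<^const>\<open>grad_inner\<close> and \<^const>\<open>grad_norm\<close>.\<close>

definition H01 :: "'a::euclidean_space set \<Rightarrow> 'a L2 set" where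
  "H01 \<Omega> = {g \<in> H1 \<Omega>. \<exists>\<psi>. (\<forall>k::nat. test_fun \<Omega> (\<psi> k)) \<and>
     (\<lambda>k. H1_norm \<Omega> (abs_L2 (\<psi> k) - g)) \<longlonglongrightarrow> 0}"

text \<open>Near each boundary point, after a rotation taking \<open>e\<close> to the last coordinate direction,
  \<open>\<Omega>\<close> is the open epigraph of a Lipschitz function \<open>\<gamma>\<close> of the coordinates
  orthogonal to \<open>e\<close>.\<close>

definition lipschitz_boundary :: "'a::euclidean_space set \<Rightarrow> bool" where
  "lipschitz_boundary \<Omega> \<longleftrightarrow>
     (\<forall>x\<in>frontier \<Omega>. \<exists>e \<delta> L \<gamma>. norm e = 1 \<and> \<delta> > 0 \<and>
        L-lipschitz_on {y. y \<bullet> e = 0} (\<gamma> :: 'a \<Rightarrow> real) \<and>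
        \<Omega> \<inter> ball x \<delta> = {y \<in> ball x \<delta>. y \<bullet> e > \<gamma> (y - (y \<bullet> e) *\<^sub>R e)})"

definition bounded_lipschitz_domain :: "'a::euclidean_space set \<Rightarrow> bool" where
  "bounded_lipschitz_domain \<Omega> \<longleftrightarrow>
     \<Omega> \<noteq> {} \<and> open \<Omega> \<and> connected \<Omega> \<and> bounded \<Omega> \<and> lipschitz_boundary \<Omega>"

definition fe_space :: "'a::euclidean_space set \<Rightarrow> 'a L2 set \<Rightarrow> bool" where
  "fe_space \<Omega> W \<longleftrightarrow>
     subspace W \<and> W \<subseteq> H01 \<Omega> \<and> (\<exists>B. finite B \<and> W = span B)"

definition time_step :: "real \<Rightarrow> nat \<Rightarrow> real" where
  "time_step T N = T / (real N - 1)"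

definition time_node :: "real \<Rightarrow> nat \<Rightarrow> nat \<Rightarrow> real" where
  "time_node T N n = (real n - 1) * time_step T N"

definition diff_quot :: "real \<Rightarrow> (nat \<Rightarrow> 'v::real_vector) \<Rightarrow> nat \<Rightarrow> 'v" where
  "diff_quot dt z n = (z (n + 1) - z n) /\<^sub>R dt"

text \<open>Sequences are indexed from \<open>1\<close>; only the values at \<open>1, \<dots>, N\<close> are used.\<close>

definition backward_euler ::
    "'a::euclidean_space set \<Rightarrow> real \<Rightarrow> (real \<Rightarrow> 'a L2) \<Rightarrow> real \<Rightarrow> nat \<Rightarrow>
     'a L2 set \<Rightarrow> (nat \<Rightarrow> 'a L2) \<Rightarrow> bool" where
  "backward_euler \<Omega> \<nu> f T N W u \<longleftrightarrow>
     (\<forall>n\<in>{1..N}. u n \<in> W) \<and>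
     (\<forall>n\<in>{1..N-1}. \<forall>v\<in>W.
        inner (diff_quot (time_step T N) u n) v + \<nu> * grad_inner \<Omega> (u (n + 1)) v
        = inner (f (time_node T N (n + 1))) v)"

definition S_inner :: "real \<Rightarrow> nat \<Rightarrow> (nat \<Rightarrow> real) \<Rightarrow> (nat \<Rightarrow> real) \<Rightarrow> real" where
  "S_inner dt N g h = g 1 * h 1 + dt * (\<Sum>j=2..N. g j * h j)"

definition K1 ::
    "real \<Rightarrow> nat \<Rightarrow> (nat \<Rightarrow> 'a::euclidean_space L2) \<Rightarrow> (nat \<Rightarrow> real) \<Rightarrow> 'a L2" where
  "K1 dt N u g =
     g 1 *\<^sub>R u 1 + (\<Sum>j=1..N-1. (dt * g (j + 1)) *\<^sub>R diff_quot dt u j)"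

text \<open>
  A singular value decomposition of \<^const>\<open>K1\<close> with singular values \<open>sqrt (lam i)\<close>, where
  \<open>f\<^sub>1, \<dots>, f\<^sub>N\<close> is an orthonormal basis of the \<open>N\<close>-dimensional space \<open>S\<close>. The
  number \<open>M \<ge> N\<close> of orthonormal vectors in \<open>X = L\<^sup>2(\<Omega>)\<close> is arbitrary, as \<open>X\<close> is
  infinite-dimensional; the modes \<open>\<phi> i\<close> with \<open>i > N\<close> belong to the eigenvalue \<open>0\<close>.
\<close>

definition is_pod_svd ::
    "'a::euclidean_space set \<Rightarrow> real \<Rightarrow> nat \<Rightarrow> (nat \<Rightarrow> 'a L2) \<Rightarrow>
     (nat \<Rightarrow> real) \<Rightarrow> (nat \<Rightarrow> nat \<Rightarrow> real) \<Rightarrow> nat \<Rightarrow> (nat \<Rightarrow> 'a L2) \<Rightarrow> bool" where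
  "is_pod_svd \<Omega> dt N u lam fs M \<phi> \<longleftrightarrow>
     N \<le> M \<and>
     (\<forall>i\<in>{1..N}. 0 \<le> lam i) \<and>
     (\<forall>i\<in>{1..N}. \<forall>j\<in>{1..N}. i \<le> j \<longrightarrow> lam j \<le> lam i) \<and>
     (\<forall>i\<in>{1..N}. \<forall>j\<in>{1..N}. S_inner dt N (fs i) (fs j) = (if i = j then 1 else 0)) \<and>
     (\<forall>i\<in>{1..M}. \<phi> i \<in> L2_on \<Omega>) \<and>
     (\<forall>i\<in>{1..M}. \<forall>j\<in>{1..M}. inner (\<phi> i) (\<phi> j) = (if i = j then 1 else 0)) \<and>
     (\<forall>i\<in>{1..N}. K1 dt N u (fs i) = sqrt (lam i) *\<^sub>R \<phi> i)"

definition num_pos :: "nat \<Rightarrow> (nat \<Rightarrow> real) \<Rightarrow> nat" where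
  "num_pos N lam = card {i \<in> {1..N}. lam i > 0}"

definition L2_proj :: "'a::euclidean_space L2 set \<Rightarrow> 'a L2 \<Rightarrow> 'a L2" where
  "L2_proj W g = (THE p. p \<in> W \<and> (\<forall>v\<in>W. inner (g - p) v = 0))"

definition ritz_proj ::
    "'a::euclidean_space set \<Rightarrow> 'a L2 set \<Rightarrow> 'a L2 \<Rightarrow> 'a L2" where
  "ritz_proj \<Omega> W w = (THE p. p \<in> W \<and> (\<forall>v\<in>W. grad_inner \<Omega> (w - p) v = 0))"

end

theory Submission
  imports Defs
begin

text \<open>
  Write \<open>R\<close> for the Ritz projection onto the POD space and split the error as
  \<open>e\<^sup>k = \<eta>\<^sup>k - \<phi>\<^sup>k\<close> with \<open>\<eta>\<^sup>k = u\<^sup>k - R u\<^sup>k\<close> and \<open>\<phi>\<^sup>k = u\<^sub>r\<^sup>k - R u\<^sup>k\<close>.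
  Apart from the initial value of \<open>\<phi>\<close>, both parts are controlled by the one quantity
  \<open>Q = E u\<^sup>1 + \<Sum>\<^sub>n \<Delta>t E (\<partial>u\<^sup>n)\<close>, where
  \<open>E x = \<parallel>x - R x\<parallel>\<^sup>2 + \<parallel>\<nabla>(x - R x)\<parallel>\<^sup>2\<close>.

  The projection error is \<open>\<eta>\<^sup>k = \<eta>\<^sup>1 + \<Sum>\<^sub>n \<Delta>t \<partial>\<eta>\<^sup>n\<close>, so that the Cauchy-Schwarz
  inequality in time bounds \<open>\<parallel>\<nabla>\<eta>\<^sup>k\<parallel>\<^sup>2\<close> by \<open>2 max(1,T) Q\<close>. For the discrete error the forcing
  cancels between the two schemes, because the POD space lies in the finite element space, and
  Ritz orthogonality removes \<open>\<nabla>\<eta>\<close>; what remains is a backward Euler equation for \<open>\<phi>\<close> with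
  right-hand side \<open>\<partial>\<eta>\<^sup>n\<close>. Testing it with \<open>\<partial>\<phi>\<^sup>n\<close> (\<open>backward_euler_energy_step\<close>) makes
  \<open>\<parallel>\<nabla>\<phi>\<^sup>k\<parallel>\<^sup>2\<close> grow by at most \<open>(1/\<nu>) \<Sum>\<^sub>n \<Delta>t \<parallel>\<partial>\<eta>\<^sup>n\<parallel>\<^sup>2\<close>. Together this is
  \<open>res_error_estimate\<close>.

  The quantity \<open>Q\<close> equals \<open>\<Sum>\<^sub>i \<lambda>\<^sub>i E \<phi>\<^sub>i\<close> exactly (\<open>pod_energy_identity\<close>): it is the squared
  Hilbert-Schmidt norm of \<open>K\<^sub>1\<close> followed by \<open>I - R\<close>, as a map from \<open>S\<close> into \<open>H\<^sup>1\<close>, and this norm may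
  be computed in the orthonormal basis of scaled unit vectors or in the basis of singular vectors. The modes in the POD
  space are fixed by \<open>R\<close>, so only \<open>i > r\<close> contributes.

  This argument is algebra in an inner product space with a second form \<open>a\<close>, the gradient form.
  The domain enters only through two facts about \<open>a\<close>. It is bilinear on \<open>H\<^sup>1\<close>, which amounts to
  the uniqueness of weak derivatives and so to the fundamental lemma of the calculus of variations
  (\<open>L2_on_eq_0\<close>). It is definite on \<open>H\<^sup>1\<^sub>0\<close> (\<open>grad_inner_definite\<close>), so that the Ritz projection
  is well defined; for a bounded domain this follows by using \<open>x\<^sub>b \<psi>\<close> as a test function.
\<close>

section \<open>Smooth functions\<close>

lemma partial_deriv_eq:
  assumes "(f has_derivative f') (at x)"
  shows "partial_deriv b f x = f' b"
  using frechet_derivative_at[OF assms] by (simp add: partial_deriv_def)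

lemma smooth_fun_differentiable: "smooth_fun f \<Longrightarrow> f differentiable (at x)"
  unfolding smooth_fun_def by (drule spec[of _ "[]"]) (simp add: differentiable_on_def)

lemma smooth_fun_partial_deriv:
  assumes "smooth_fun f" "b \<in> Basis"
  shows "smooth_fun (partial_deriv b f)"
  unfolding smooth_fun_def
proof (intro allI impI)
  fix bs :: "'a list" assume "set bs \<subseteq> Basis"
  then have "set (b # bs) \<subseteq> Basis" using assms(2) by simp
  then have "fold partial_deriv (b # bs) f differentiable_on UNIV"
    using assms(1) unfolding smooth_fun_def by blast
  then show "fold partial_deriv bs (partial_deriv b f) differentiable_on UNIV" by simp
qed

text \<open>
  Smoothness is the largest property that implies differentiability and is stable under the
  coordinate derivatives. Smoothness proofs below exhibit such a property instead of computing
  iterated derivatives.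
\<close>

lemma smooth_fun_coinduct:
  assumes "P f"
    and diff: "\<And>f x. P f \<Longrightarrow> f differentiable (at x)"
    and step: "\<And>f b. P f \<Longrightarrow> b \<in> Basis \<Longrightarrow> P (partial_deriv b f)"
  shows "smooth_fun f"
proof -
  have "set bs \<subseteq> Basis \<Longrightarrow> P f \<Longrightarrow> fold partial_deriv bs f differentiable_on UNIV" for bs f
    by (induction bs arbitrary: f) (auto simp: differentiable_on_def diff step)
  with \<open>P f\<close> show ?thesis unfolding smooth_fun_def by blast
qed

text \<open>
  The derivative of a product is a sum of two products, so products of smooth functions do not
  form a class closed under differentiation, but the algebra generated by the smooth functions
  does.
\<close>

inductive smooth_alg :: "('a::euclidean_space \<Rightarrow> real) \<Rightarrow> bool" where
  base: "smooth_fun f \<Longrightarrow> smooth_alg f"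
| add: "smooth_alg f \<Longrightarrow> smooth_alg g \<Longrightarrow> smooth_alg (\<lambda>x. f x + g x)"
| mult: "smooth_alg f \<Longrightarrow> smooth_alg g \<Longrightarrow> smooth_alg (\<lambda>x. f x * g x)"

lemma partial_deriv_add:
  assumes "f differentiable (at x)" "g differentiable (at x)"
  shows "partial_deriv b (\<lambda>x. f x + g x) x = partial_deriv b f x + partial_deriv b g x"
proof -
  obtain f' g' where "(f has_derivative f') (at x)" "(g has_derivative g') (at x)"
    using assms unfolding differentiable_def by blast
  note fg = this
  then have "((\<lambda>x. f x + g x) has_derivative (\<lambda>h. f' h + g' h)) (at x)"
    by (rule has_derivative_add)
  from partial_deriv_eq[OF this] partial_deriv_eq[OF fg(1)] partial_deriv_eq[OF fg(2)]
  show ?thesis by simp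
qed

lemma partial_deriv_mult:
  assumes "f differentiable (at x)" "g differentiable (at x)"
  shows "partial_deriv b (\<lambda>x. f x * g x) x = f x * partial_deriv b g x + partial_deriv b f x * g x"
proof -
  obtain f' g' where "(f has_derivative f') (at x)" "(g has_derivative g') (at x)"
    using assms unfolding differentiable_def by blast
  note fg = this
  then have "((\<lambda>x. f x * g x) has_derivative (\<lambda>h. f x * g' h + f' h * g x)) (at x)"
    by (rule has_derivative_mult)
  from partial_deriv_eq[OF this] partial_deriv_eq[OF fg(1)] partial_deriv_eq[OF fg(2)]
  show ?thesis by simp
qed

lemma smooth_fun_if_smooth_alg:
  assumes "smooth_alg f" shows "smooth_fun f"
proof (rule smooth_fun_coinduct[of smooth_alg, OF assms])
  show diff: "f differentiable (at x)" if "smooth_alg f" for f :: "'a \<Rightarrow> real" and x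
    using that by induction (auto simp: smooth_fun_differentiable)
  show "smooth_alg (partial_deriv b f)" if "smooth_alg f" "b \<in> Basis" for f and b :: 'a
    using that
  proof (induction)
    case (base f)
    then show ?case by (auto intro: smooth_alg.base smooth_fun_partial_deriv)
  next
    case (add f g)
    have "partial_deriv b (\<lambda>x. f x + g x) = (\<lambda>x. partial_deriv b f x + partial_deriv b g x)"
      using add by (auto simp: partial_deriv_add diff)
    then show ?case using add by (auto intro: smooth_alg.add)
  next
    case (mult f g)
    have "partial_deriv b (\<lambda>x. f x * g x)
        = (\<lambda>x. f x * partial_deriv b g x + partial_deriv b f x * g x)"
      using mult by (auto simp: partial_deriv_mult diff)
    then show ?case using mult by (auto intro: smooth_alg.intros)
  qed
qed

lemma smooth_fun_mult: "smooth_fun f \<Longrightarrow> smooth_fun g \<Longrightarrow> smooth_fun (\<lambda>x. f x * g x)"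
  by (rule smooth_fun_if_smooth_alg) (rule smooth_alg.mult smooth_alg.base | assumption)+

lemma smooth_fun_const: "smooth_fun (\<lambda>x. c)"
proof (rule smooth_fun_coinduct[where P = "\<lambda>f. \<exists>c. f = (\<lambda>x. c)"])
  fix f :: "'a \<Rightarrow> real" and b :: 'a
  assume "\<exists>c. f = (\<lambda>x. c)"
  then have "partial_deriv b f = (\<lambda>x. 0)" by (auto simp: partial_deriv_def)
  then show "\<exists>c. partial_deriv b f = (\<lambda>x. c)" by blast
qed auto

lemma smooth_fun_prod:
  "finite I \<Longrightarrow> (\<And>i. i \<in> I \<Longrightarrow> smooth_fun (f i)) \<Longrightarrow> smooth_fun (\<lambda>x. \<Prod>i\<in>I. f i x)"
proof (induction I rule: finite_induct)
  case empty
  show ?case using smooth_fun_const[of 1] by simp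
next
  case (insert i I)
  then have "smooth_fun (\<lambda>x. f i x * (\<Prod>i\<in>I. f i x))" by (auto intro!: smooth_fun_mult[of "f i"])
  with insert show ?case by simp
qed

lemma partial_deriv_coord: "partial_deriv b (\<lambda>x. x \<bullet> c) x = b \<bullet> c"
  by (rule partial_deriv_eq[OF bounded_linear_imp_has_derivative[OF bounded_linear_inner_left]])

lemma smooth_fun_coord: "smooth_fun (\<lambda>x. x \<bullet> c)"
proof (rule smooth_fun_coinduct[where P = "\<lambda>f. smooth_fun f \<or> f = (\<lambda>x. x \<bullet> c)"])
  fix f and b :: 'a
  assume "smooth_fun f \<or> f = (\<lambda>x. x \<bullet> c)" "b \<in> Basis"
  moreover have "partial_deriv b (\<lambda>x. x \<bullet> c) = (\<lambda>x. b \<bullet> c)"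
    by (simp add: partial_deriv_coord fun_eq_iff)
  ultimately have "smooth_fun (partial_deriv b f)"
    using smooth_fun_const[of "b \<bullet> c"] smooth_fun_partial_deriv[of f b] by fastforce
  then show "smooth_fun (partial_deriv b f) \<or> partial_deriv b f = (\<lambda>x. x \<bullet> c)" ..
next
  fix f x assume "smooth_fun f \<or> f = (\<lambda>x. x \<bullet> c)"
  moreover have "(\<lambda>x. x \<bullet> c) differentiable (at x)"
    by (simp add: bounded_linear_imp_differentiable bounded_linear_inner_left)
  ultimately show "f differentiable (at x)"
    using smooth_fun_differentiable by blast
qed simp

text \<open>
  For \<open>p = 1\<close> this is the standard smooth function that vanishes to infinite order at \<open>0\<close>; the
  polynomial factor in \<open>1 / t\<close> makes the family closed under differentiation.
\<close>

definition flat :: "real poly \<Rightarrow> real \<Rightarrow> real" where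
  "flat p t = (if t > 0 then poly p (1 / t) * exp (- (1 / t)) else 0)"

text \<open>
  With \<open>s = 1 / t\<close> this gives the differentiability of \<open>flat\<close> at \<open>0\<close>.
\<close>

lemma poly_exp_minus_tendsto_0: "((\<lambda>s::real. poly p s * exp (- s)) \<longlongrightarrow> 0) at_top"
proof (induction p)
  case 0
  then show ?case by simp
next
  case (pCons a p)
  have "((\<lambda>s::real. s ^ k / exp s) \<longlongrightarrow> 0) at_top" for k
    by (rule tendsto_power_div_exp_0)
  then have *: "((\<lambda>s::real. a * (s ^ 0 / exp s) + (\<Sum>i\<le>degree p. coeff p i * (s ^ Suc i / exp s))) \<longlongrightarrow> 0) at_top"
    by (intro tendsto_add_zero tendsto_null_sum tendsto_mult_right_zero)
  have "poly (pCons a p) s * exp (- s) = a * (s ^ 0 / exp s) + (\<Sum>i\<le>degree p. coeff p i * (s ^ Suc i / exp s))" for s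
    unfolding poly_pCons poly_altdef[of p]
    by (simp add: exp_minus sum_distrib_left sum_distrib_right field_simps)
  then show ?case using * by simp
qed

text \<open>
  For \<open>t > 0\<close> the chain rule gives
  \<open>(p(1/t) e\<^sup>-\<^sup>1\<^sup>/\<^sup>t)' = t\<^sup>-\<^sup>2 (p - p')(1/t) e\<^sup>-\<^sup>1\<^sup>/\<^sup>t\<close>, and the factor \<open>t\<^sup>-\<^sup>2\<close> is the
  polynomial \<open>[:0,0,1:]\<close> at \<open>1/t\<close>. At \<open>0\<close> the exponential decay beats every polynomial.
\<close>

lemma flat_has_derivative:
  "(flat p has_real_derivative flat ([:0,0,1:] * (p - pderiv p)) t) (at t)"
proof -
  consider "t > 0" | "t < 0" | "t = 0" by linarith
  then show ?thesis
  proof cases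
    case 1
    have "((\<lambda>t. poly p (1 / t) * exp (- (1 / t))) has_real_derivative
         flat ([:0,0,1:] * (p - pderiv p)) t) (at t)"
      using 1 by (auto intro!: derivative_eq_intros DERIV_chain'[OF _ poly_DERIV] simp: flat_def field_simps power2_eq_square)
    then show ?thesis
      by (rule has_field_derivative_transform_within_open[of _ _ _ "{0<..}"]) (use 1 in \<open>auto simp: flat_def\<close>)
  next
    case 2
    have "((\<lambda>t::real. 0) has_real_derivative flat ([:0,0,1:] * (p - pderiv p)) t) (at t)"
      using 2 by (simp add: flat_def)
    then show ?thesis
      by (rule has_field_derivative_transform_within_open[of _ _ _ "{..<0}"]) (use 2 in \<open>auto simp: flat_def\<close>)
  next
    case 3
    \<comment> \<open>dividing by \<open>h\<close> replaces \<open>p\<close> by \<open>X p\<close> in the variable \<open>1 / h\<close>\<close>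
    have "((\<lambda>h. flat p h / h) \<longlongrightarrow> 0) (at 0)"
    proof (rule filterlim_split_at)
      show "((\<lambda>h. flat p h / h) \<longlongrightarrow> 0) (at_left 0)"
        by (rule tendsto_eventually) (auto simp: eventually_at_filter flat_def)
      have "((\<lambda>h. poly (pCons 0 p) (inverse h) * exp (- inverse h)) \<longlongrightarrow> 0) (at_right 0)"
        by (rule filterlim_compose[OF poly_exp_minus_tendsto_0 filterlim_inverse_at_top_right])
      moreover have "\<forall>\<^sub>F h in at_right 0. poly (pCons 0 p) (inverse h) * exp (- inverse h) = flat p h / h"
        by (auto simp: eventually_at_filter flat_def field_simps)
      ultimately show "((\<lambda>h. flat p h / h) \<longlongrightarrow> 0) (at_right 0)"
        by (rule Lim_transform_eventually)
    qed
    then show ?thesis using 3 by (simp add: DERIV_def flat_def)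
  qed
qed

lemma smooth_fun_flat: "smooth_fun (\<lambda>x. flat p (x \<bullet> v + d))"
proof (rule smooth_fun_coinduct[where P = "\<lambda>f. \<exists>c p. f = (\<lambda>x. c * flat p (x \<bullet> v + d))"])
  have D: "((\<lambda>x. c * flat p (x \<bullet> v + d)) has_derivative
      (\<lambda>h. c * ((h \<bullet> v) * flat ([:0,0,1:] * (p - pderiv p)) (x \<bullet> v + d)))) (at x)" for c p x
    by (rule derivative_eq_intros
        has_derivative_compose[OF _ flat_has_derivative[unfolded has_field_derivative_def], of "\<lambda>x. x \<bullet> v + d"] refl
      | simp add: algebra_simps)+
  show "\<exists>c q. (\<lambda>x. flat p (x \<bullet> v + d)) = (\<lambda>x. c * flat q (x \<bullet> v + d))"
    by (rule exI[of _ 1]) auto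
  show "f differentiable (at x)" if "\<exists>c p. f = (\<lambda>x. c * flat p (x \<bullet> v + d))" for f x
    using that D unfolding differentiable_def by blast
  show "\<exists>c p. partial_deriv b f = (\<lambda>x. c * flat p (x \<bullet> v + d))"
    if ex: "\<exists>c p. f = (\<lambda>x. c * flat p (x \<bullet> v + d))" for f b
  proof -
    obtain c p where f: "f = (\<lambda>x. c * flat p (x \<bullet> v + d))" using ex by blast
    have "partial_deriv b f = (\<lambda>x. (c * (b \<bullet> v)) * flat ([:0,0,1:] * (p - pderiv p)) (x \<bullet> v + d))"
      unfolding f by (rule ext) (simp add: partial_deriv_eq[OF D])
    then show ?thesis by blast
  qed
qed

section \<open>Test functions and integration by parts\<close>

lemma test_fun_continuous: "test_fun \<Omega> \<psi> \<Longrightarrow> continuous_on S \<psi>"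
  by (meson continuous_at_imp_continuous_on differentiable_imp_continuous_within
      smooth_fun_differentiable test_fun_def)

text \<open>
  The complement of the compact support is open, hence the derivative vanishes there as well.
\<close>

lemma test_fun_partial_deriv:
  assumes "test_fun \<Omega> \<psi>" "b \<in> Basis"
  shows "test_fun \<Omega> (partial_deriv b \<psi>)"
proof -
  obtain K where K: "compact K" "K \<subseteq> \<Omega>" "\<And>x. x \<notin> K \<Longrightarrow> \<psi> x = 0" "smooth_fun \<psi>"
    using assms unfolding test_fun_def by blast
  have "partial_deriv b \<psi> x = 0" if "x \<notin> K" for x
  proof -
    have "((\<lambda>x. 0) has_derivative (\<lambda>h. 0)) (at x)" by simp
    then have "(\<psi> has_derivative (\<lambda>h. 0)) (at x)"
      by (rule has_derivative_transform_within_open[of _ _ _ _ "- K"])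
        (use K that in \<open>auto simp: compact_imp_closed open_Compl\<close>)
    from partial_deriv_eq[OF this] show ?thesis .
  qed
  then show ?thesis
    unfolding test_fun_def using K smooth_fun_partial_deriv[OF K(4) assms(2)] by blast
qed

lemma test_fun_mult:
  assumes "smooth_fun g" "test_fun \<Omega> \<psi>"
  shows "test_fun \<Omega> (\<lambda>x. g x * \<psi> x)"
proof -
  obtain K where K: "compact K" "K \<subseteq> \<Omega>" "\<And>x. x \<notin> K \<Longrightarrow> \<psi> x = 0" "smooth_fun \<psi>"
    using assms(2) unfolding test_fun_def by blast
  then have "\<forall>x. x \<notin> K \<longrightarrow> g x * \<psi> x = 0" by simp
  then show ?thesis
    unfolding test_fun_def using K(1,2) smooth_fun_mult[OF assms(1) K(4)] by blast
qed

lemma integrable_compact_support: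
  fixes g :: "'a::euclidean_space \<Rightarrow> real"
  assumes "continuous_on UNIV g" "compact K" "\<And>x. x \<notin> K \<Longrightarrow> g x = 0"
  shows "integrable lborel g"
proof -
  have "integrable lborel (\<lambda>x. indicator K x *\<^sub>R g x)"
    using assms by (intro borel_integrable_compact continuous_on_subset[OF assms(1)]) auto
  moreover have "(\<lambda>x. indicator K x *\<^sub>R g x) = g"
    proof
    show "indicator K x *\<^sub>R g x = g x" for x
      using assms(3)[of x] by (cases "x \<in> K") auto
  qed
  ultimately show ?thesis by simp
qed

lemma test_fun_sq_integrable:
  assumes "test_fun \<Omega> \<psi>"
  shows "sq_integrable \<psi>"
proof -
  obtain K where K: "compact K" "\<And>x. x \<notin> K \<Longrightarrow> \<psi> x = 0"
    using assms unfolding test_fun_def by blast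
  have c: "continuous_on UNIV \<psi>" by (rule test_fun_continuous[OF assms])
  then have [measurable]: "\<psi> \<in> borel_measurable borel" by (rule borel_measurable_continuous_onI)
  have "integrable lborel (\<lambda>x. (\<psi> x)\<^sup>2)"
    using K by (intro integrable_compact_support[of _ K] continuous_on_power c) auto
  then have "integrable lebesgue (\<lambda>x. (\<psi> x)\<^sup>2)"
    by (subst integrable_completion) measurable
  moreover have "\<psi> \<in> borel_measurable lebesgue" by (intro measurable_completion) measurable
  ultimately show ?thesis unfolding sq_integrable_def by blast
qed

lemma inner_abs_L2:
  assumes "sq_integrable g" "sq_integrable h"
  shows "inner (abs_L2 g) (abs_L2 h) = (\<integral>x. g x * h x \<partial>lebesgue)"
  using assms by (simp add: inner_L2.abs_eq)

lemma abs_L2_eqI: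
  assumes "sq_integrable g" "sq_integrable h" "AE x in lebesgue. g x = h x"
  shows "abs_L2 g = abs_L2 h"
  by (rule Quotient_rel_abs[OF Quotient_L2]) (use assms in simp)

text \<open>
  A Borel representative allows passing between Lebesgue measure and its restriction to Borel sets,
  where \<open>\<pi>\<close>-\<open>\<lambda>\<close> arguments are possible.
\<close>

lemma L2_borel_representative:
  fixes G :: "'a::euclidean_space L2"
  obtains g where "sq_integrable g" "g \<in> borel_measurable borel" "G = abs_L2 g"
proof -
  have "\<exists>g. sq_integrable g \<and> G = abs_L2 g" by (induct G rule: L2.abs_induct) auto
  then obtain g where g: "sq_integrable g" "G = abs_L2 g" by blast
  then obtain g' where g': "g' \<in> borel_measurable lborel" "AE x in lborel. g x = g' x"
    using completion_ex_borel_measurable_real[of g lborel] unfolding sq_integrable_def by blast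
  have ae: "AE x in lebesgue. g x = g' x" by (rule AE_completion[OF g'(2)])
  have m: "g' \<in> borel_measurable lebesgue" by (rule measurable_completion[OF g'(1)])
  have "integrable lebesgue (\<lambda>x. (g' x)\<^sup>2) = integrable lebesgue (\<lambda>x. (g x)\<^sup>2)"
    using ae g m by (intro integrable_cong_AE) (auto simp: sq_integrable_def)
  then have "sq_integrable g'" using g m by (simp add: sq_integrable_def)
  with that[of g'] g g' abs_L2_eqI[OF g(1) _ ae] show ?thesis by simp
qed

lemma vanishes_outside_abs_L2:
  "sq_integrable g \<Longrightarrow> vanishes_outside \<Omega> (abs_L2 g) \<longleftrightarrow> (AE x in lebesgue. x \<notin> \<Omega> \<longrightarrow> g x = 0)"
  by (simp add: vanishes_outside.abs_eq)

lemma test_fun_in_L2_on: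
  assumes "test_fun \<Omega> \<psi>"
  shows "abs_L2 \<psi> \<in> L2_on \<Omega>"
proof -
  have "\<psi> x = 0" if "x \<notin> \<Omega>" for x
    using assms that unfolding test_fun_def by blast
  then show ?thesis
    by (simp add: L2_on_def vanishes_outside_abs_L2 test_fun_sq_integrable[OF assms])
qed

text \<open>
  Lebesgue measure is translation invariant, so every difference quotient
  \<open>(F(x + h b) - F x) / h\<close> has integral zero. By the mean value theorem these quotients are bounded
  by the maximum of the derivative, and for \<open>0 < h \<le> 1\<close> they live on a common compact set; dominated
  convergence as \<open>h \<rightarrow> 0\<close> gives the claim.
\<close>

lemma integral_partial_deriv_test_fun:
  assumes F: "test_fun \<Omega> F" and b: "b \<in> Basis"
  shows "(\<integral>x. partial_deriv b F x \<partial>lebesgue) = 0"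
proof -
  obtain K where K: "compact K" "K \<subseteq> \<Omega>" "\<And>x. x \<notin> K \<Longrightarrow> F x = 0" "smooth_fun F"
    using F unfolding test_fun_def by blast
  have dF: "test_fun \<Omega> (partial_deriv b F)"
    by (rule test_fun_partial_deriv[OF F b])
  have cF: "continuous_on UNIV F" and cdF: "continuous_on UNIV (partial_deriv b F)"
    using test_fun_continuous F dF by blast+
  have [measurable]: "F \<in> borel_measurable borel" "partial_deriv b F \<in> borel_measurable borel"
    by (intro borel_measurable_continuous_onI cF cdF)+
  obtain K' where K': "compact K'" "\<And>x. x \<notin> K' \<Longrightarrow> partial_deriv b F x = 0"
    using dF unfolding test_fun_def by blast
  have "bounded (partial_deriv b F ` K')"
    by (intro compact_imp_bounded compact_continuous_image K' test_fun_continuous[OF dF])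
  then obtain B0 where B0: "\<And>x. x \<in> K' \<Longrightarrow> \<bar>partial_deriv b F x\<bar> \<le> B0"
    unfolding bounded_iff by auto
  define B where "B = max 0 B0"
  have B: "\<bar>partial_deriv b F x\<bar> \<le> B" "0 \<le> B" for x
    using B0[of x] K'(2)[of x] by (cases "x \<in> K'"; force simp: B_def)+
  have line: "((\<lambda>t. F (x + t *\<^sub>R b)) has_real_derivative partial_deriv b F (x + t *\<^sub>R b)) (at t)" for x t
  proof -
    have "(F has_derivative frechet_derivative F (at (x + t *\<^sub>R b))) (at (x + t *\<^sub>R b))"
      using smooth_fun_differentiable[OF K(4)] frechet_derivative_works by blast
    moreover have "((\<lambda>t. x + t *\<^sub>R b) has_derivative (\<lambda>h. h *\<^sub>R b)) (at t)"
      by (auto intro!: derivative_eq_intros)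
    ultimately have "((\<lambda>t. F (x + t *\<^sub>R b)) has_derivative
        (\<lambda>h. frechet_derivative F (at (x + t *\<^sub>R b)) (h *\<^sub>R b))) (at t)"
      by (rule has_derivative_compose[rotated])
    moreover have "linear (frechet_derivative F (at (x + t *\<^sub>R b)))"
      by (rule linear_frechet_derivative[OF smooth_fun_differentiable[OF K(4)]])
    ultimately show ?thesis
      by (simp add: has_field_derivative_def partial_deriv_def linear_cmul mult_commute_abs)
  qed
  define h :: "nat \<Rightarrow> real" where "h n = inverse (Suc n)" for n
  have h: "0 < h n" "h n \<le> 1" for n by (auto simp: h_def divide_simps)
  define D where "D n x = (F (x + h n *\<^sub>R b) - F x) / h n" for n x
  \<comment> \<open>the points from which \<open>K\<close> is reached by a step of length at most one in direction \<open>b\<close>\<close>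
  define L where "L = {x + y |x y. x \<in> K \<and> y \<in> closed_segment 0 (- b)}"
  have L: "compact L" unfolding L_def by (intro compact_sums K compact_segment)
  have KL: "K \<subseteq> L" unfolding L_def by force
  have "(\<lambda>n. \<integral>x. D n x \<partial>lborel) \<longlonglongrightarrow> (\<integral>x. partial_deriv b F x \<partial>lborel)"
  proof (rule integral_dominated_convergence)
    show "integrable lborel (\<lambda>x. B * indicator L x)"
      using borel_integrable_compact[OF L, of "\<lambda>x. B"] by (simp add: mult.commute)
    show "AE x in lborel. (\<lambda>n. D n x) \<longlonglongrightarrow> partial_deriv b F x"
    proof (rule AE_I2)
      fix x
      have "((\<lambda>t. (F (x + t *\<^sub>R b) - F x) / t) \<longlongrightarrow> partial_deriv b F x) (at 0)"
        using line[of x 0] by (simp add: DERIV_def)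
      moreover have "filterlim h (at 0) sequentially"
        unfolding filterlim_at using h LIMSEQ_inverse_real_of_nat
        by (auto simp: h_def[abs_def] intro!: always_eventually)
      ultimately show "(\<lambda>n. D n x) \<longlonglongrightarrow> partial_deriv b F x"
        unfolding D_def by (rule filterlim_compose)
    qed
    show "AE x in lborel. norm (D n x) \<le> B * indicator L x" for n
    proof (rule AE_I2)
      fix x
      show "norm (D n x) \<le> B * indicator L x"
      proof (cases "x \<in> L")
        case True
        have "\<exists>z>0. z < h n \<and> F (x + h n *\<^sub>R b) - F (x + 0 *\<^sub>R b) = (h n - 0) * partial_deriv b F (x + z *\<^sub>R b)"
          by (rule MVT2[where f = "\<lambda>t. F (x + t *\<^sub>R b)"]) (use h line in auto)
        then obtain z where "F (x + h n *\<^sub>R b) - F x = h n * partial_deriv b F (x + z *\<^sub>R b)"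
          by auto
        then show ?thesis using True B(1)[of "x + z *\<^sub>R b"] h(1)[of n] by (simp add: D_def)
      next
        case False
        have "x + h n *\<^sub>R b \<notin> K"
        proof
          assume "x + h n *\<^sub>R b \<in> K"
          moreover have "- (h n *\<^sub>R b) \<in> closed_segment 0 (- b)"
            using h[of n] by (auto simp: in_segment intro!: exI[of _ "h n"])
          ultimately have "(x + h n *\<^sub>R b) + - (h n *\<^sub>R b) \<in> L" unfolding L_def by blast
          with False show False by simp
        qed
        then show ?thesis using False KL K(3) by (auto simp: D_def)
      qed
    qed
  qed (auto simp: D_def)
  moreover have "(\<integral>x. D n x \<partial>lborel) = 0" for n
  proof -
    have i: "integrable lborel F" by (rule integrable_compact_support[OF cF K(1,3)])
    have "integrable (distr lborel borel ((+) (h n *\<^sub>R b))) F"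
      using i by (simp add: lborel_distr_plus)
    then have i2: "integrable lborel (\<lambda>x. F (h n *\<^sub>R b + x))"
      by (subst (asm) integrable_distr_eq) auto
    have "(\<integral>x. F x \<partial>lborel) = (\<integral>x. F x \<partial>distr lborel borel ((+) (h n *\<^sub>R b)))"
      by (simp add: lborel_distr_plus)
    also have "\<dots> = (\<integral>x. F (h n *\<^sub>R b + x) \<partial>lborel)"
      by (subst integral_distr) auto
    finally show ?thesis using i i2 by (simp add: D_def add.commute)
  qed
  ultimately have "(\<integral>x. partial_deriv b F x \<partial>lborel) = 0"
    by (simp add: LIMSEQ_const_iff)
  then show ?thesis by (subst integral_completion) auto
qed

text \<open>
  Integration by parts: the integral of the derivative of the product of two test functions
  vanishes.
\<close>

lemma is_weak_deriv_test_fun: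
  assumes \<psi>: "test_fun \<Omega> \<psi>" and b: "b \<in> Basis"
  shows "is_weak_deriv \<Omega> b (abs_L2 \<psi>) (abs_L2 (partial_deriv b \<psi>))"
  unfolding is_weak_deriv_def
proof (intro conjI allI impI)
  show "abs_L2 (partial_deriv b \<psi>) \<in> L2_on \<Omega>"
    by (intro test_fun_in_L2_on test_fun_partial_deriv assms)
  fix \<eta> assume \<eta>: "test_fun \<Omega> \<eta>"
  have sm: "smooth_fun \<psi>" "smooth_fun \<eta>" using \<psi> \<eta> by (auto simp: test_fun_def)
  have sq: "sq_integrable \<psi>" "sq_integrable \<eta>" "sq_integrable (partial_deriv b \<psi>)"
      "sq_integrable (partial_deriv b \<eta>)"
    using test_fun_sq_integrable test_fun_partial_deriv assms \<eta> by blast+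
  have "partial_deriv b (\<lambda>x. \<psi> x * \<eta> x) = (\<lambda>x. \<psi> x * partial_deriv b \<eta> x + partial_deriv b \<psi> x * \<eta> x)"
    by (rule ext) (rule partial_deriv_mult[OF smooth_fun_differentiable[OF sm(1)] smooth_fun_differentiable[OF sm(2)]])
  then have "(\<integral>x. \<psi> x * partial_deriv b \<eta> x + partial_deriv b \<psi> x * \<eta> x \<partial>lebesgue) = 0"
    using integral_partial_deriv_test_fun[OF test_fun_mult[OF sm(1) \<eta>] b] by simp
  then have "(\<integral>x. \<psi> x * partial_deriv b \<eta> x \<partial>lebesgue) + (\<integral>x. partial_deriv b \<psi> x * \<eta> x \<partial>lebesgue) = 0"
    by (subst (asm) Bochner_Integration.integral_add) (intro sq_integrable_mult sq | simp)+
  then show "inner (abs_L2 \<psi>) (abs_L2 (partial_deriv b \<eta>)) = - inner (abs_L2 (partial_deriv b \<psi>)) (abs_L2 \<eta>)"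
    by (simp add: inner_abs_L2 sq)
qed

section \<open>Uniqueness of weak derivatives and definiteness of the gradient form\<close>

text \<open>
  Scaling the argument of \<open>flat 1\<close> by \<open>n + 1\<close> turns \<open>exp (- 1 / t)\<close> into its \<open>(n + 1)\<close>-st root,
  which tends to \<open>1\<close> for \<open>t > 0\<close> and stays \<open>0\<close> for \<open>t \<le> 0\<close>. So these functions are smooth, positive
  exactly on the open box, and converge to its indicator.
\<close>

definition box_bump :: "nat \<Rightarrow> 'a::euclidean_space \<Rightarrow> 'a \<Rightarrow> 'a \<Rightarrow> real" where
  "box_bump n a b x = (\<Prod>i\<in>Basis. flat 1 (real (Suc n) * (x \<bullet> i - a \<bullet> i)) *
     flat 1 (real (Suc n) * (b \<bullet> i - x \<bullet> i)))"

lemma flat_1_bounds: "0 \<le> flat 1 t" "flat 1 t \<le> 1"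
  by (auto simp: flat_def)

lemma box_bump_bounds: "0 \<le> box_bump n a b x" "box_bump n a b x \<le> 1"
  unfolding box_bump_def
  by (auto intro!: prod_nonneg prod_le_1 mult_le_one simp: flat_1_bounds)

lemma box_bump_outside:
  assumes "x \<notin> box a b"
  shows "box_bump n a b x = 0"
proof -
  obtain i where "i \<in> Basis" "x \<bullet> i \<le> a \<bullet> i \<or> b \<bullet> i \<le> x \<bullet> i"
    using assms by (auto simp: mem_box not_less)
  then have "\<exists>i\<in>Basis. flat 1 (real (Suc n) * (x \<bullet> i - a \<bullet> i)) * flat 1 (real (Suc n) * (b \<bullet> i - x \<bullet> i)) = 0"
    by (intro bexI[of _ i]) (auto simp: flat_def zero_less_mult_iff)
  then show ?thesis unfolding box_bump_def by (simp add: prod_zero)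
qed

lemma test_fun_box_bump:
  assumes "cbox a b \<subseteq> \<Omega>"
  shows "test_fun \<Omega> (box_bump n a b)"
proof -
  have 1: "smooth_fun (\<lambda>x. flat 1 (c * (x \<bullet> i - a \<bullet> i)))" for c i
    using smooth_fun_flat[of 1 "c *\<^sub>R i" "- c * (a \<bullet> i)"] by (simp add: algebra_simps)
  have 2: "smooth_fun (\<lambda>x. flat 1 (c * (b \<bullet> i - x \<bullet> i)))" for c i
    using smooth_fun_flat[of 1 "(- c) *\<^sub>R i" "c * (b \<bullet> i)"] by (simp add: algebra_simps)
  have "smooth_fun (\<lambda>x. box_bump n a b x)"
    unfolding box_bump_def by (rule smooth_fun_prod[OF finite_Basis smooth_fun_mult[OF 1 2]])
  moreover have "\<forall>x. x \<notin> cbox a b \<longrightarrow> box_bump n a b x = 0"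
    using box_bump_outside box_subset_cbox by blast
  ultimately show ?thesis
    unfolding test_fun_def using assms compact_cbox by blast
qed

lemma flat_1_tendsto:
  assumes "0 < s"
  shows "(\<lambda>n. flat 1 (real (Suc n) * s)) \<longlonglongrightarrow> 1"
proof -
  have "(\<lambda>n. exp (- (inverse (real (Suc n)) * inverse s))) \<longlonglongrightarrow> exp (- (0 * inverse s))"
    by (intro tendsto_intros LIMSEQ_inverse_real_of_nat)
  moreover have "flat 1 (real (Suc n) * s) = exp (- (inverse (real (Suc n)) * inverse s))" for n
    using assms by (simp add: flat_def divide_inverse mult.commute del: of_nat_Suc)
  ultimately show ?thesis by simp
qed

lemma box_bump_tendsto: "(\<lambda>n. box_bump n a b x) \<longlonglongrightarrow> indicator (box a b) x"
proof (cases "x \<in> box a b")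
  case True
  have "(\<lambda>n. box_bump n a b x) \<longlonglongrightarrow> (\<Prod>i\<in>(Basis :: 'a set). 1 * 1)"
    unfolding box_bump_def
    by (rule tendsto_prod, rule tendsto_mult; rule flat_1_tendsto) (use True in \<open>auto simp: mem_box\<close>)
  with True show ?thesis by simp
qed (simp add: box_bump_outside)

lemma sq_integrable_indicator_cbox: "sq_integrable (indicator (cbox a b) :: 'a::euclidean_space \<Rightarrow> real)"
proof -
  have "integrable lborel (indicator (cbox a b) :: 'a \<Rightarrow> real)"
    by (rule integrable_real_indicator[OF _ emeasure_lborel_cbox_finite]) simp
  then have "integrable lebesgue (indicator (cbox a b) :: 'a \<Rightarrow> real)"
    by (subst integrable_completion) auto
  moreover have "(\<lambda>x. (indicator (cbox a b) x :: real)\<^sup>2) = indicator (cbox a b)"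
    by (auto simp: indicator_def)
  ultimately show ?thesis by (auto simp: sq_integrable_def)
qed

text \<open>
  Dominated convergence along the smooth approximations of the indicator of the box.
\<close>

lemma integral_box_eq_0:
  assumes g: "sq_integrable g" and ab: "cbox a b \<subseteq> \<Omega>"
    and orth: "\<And>\<psi>. test_fun \<Omega> \<psi> \<Longrightarrow> (\<integral>x. g x * \<psi> x \<partial>lebesgue) = 0"
  shows "(\<integral>x. indicator (box a b) x * g x \<partial>lebesgue) = 0"
proof -
  have [measurable]: "g \<in> borel_measurable lebesgue" using g by (simp add: sq_integrable_def)
  have tf: "test_fun \<Omega> (box_bump n a b)" for n by (rule test_fun_box_bump[OF ab])
  have [measurable]: "box_bump n a b \<in> borel_measurable lebesgue" for n
    using test_fun_sq_integrable[OF tf] by (simp add: sq_integrable_def)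
  have "(\<lambda>n. \<integral>x. g x * box_bump n a b x \<partial>lebesgue) \<longlonglongrightarrow> (\<integral>x. indicator (box a b) x * g x \<partial>lebesgue)"
  proof (rule integral_dominated_convergence)
    show "integrable lebesgue (\<lambda>x. \<bar>indicator (cbox a b) x * g x\<bar>)"
      by (intro integrable_abs sq_integrable_mult sq_integrable_indicator_cbox g)
    show "AE x in lebesgue. (\<lambda>n. g x * box_bump n a b x) \<longlonglongrightarrow> indicator (box a b) x * g x"
      using tendsto_mult_left[OF box_bump_tendsto] by (intro AE_I2) (simp add: mult.commute)
    show "AE x in lebesgue. norm (g x * box_bump n a b x) \<le> \<bar>indicator (cbox a b) x * g x\<bar>" for n
    proof (rule AE_I2)
      fix x
      show "norm (g x * box_bump n a b x) \<le> \<bar>indicator (cbox a b) x * g x\<bar>"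
      proof (cases "x \<in> cbox a b")
        case True
        then show ?thesis
          using box_bump_bounds[of n a b x] by (simp add: abs_mult mult_left_le)
      next
        case False
        then have "x \<notin> box a b" using box_subset_cbox by blast
        then show ?thesis by (simp add: box_bump_outside)
      qed
    qed
    show "(\<lambda>x. indicator (box a b) x * g x) \<in> borel_measurable lebesgue"
      by (intro borel_measurable_times borel_measurable_indicator) auto
  qed auto
  then show ?thesis by (simp add: orth[OF tf] LIMSEQ_const_iff)
qed

text \<open>
  The sets over which \<open>f\<close> integrates to zero form a Dynkin system, and boxes are an
  intersection-stable generator of the Borel sets.
\<close>

lemma AE_zero_if_box_integrals_zero:
  fixes f :: "'a::euclidean_space \<Rightarrow> real"
  assumes f: "integrable lborel f" and zero: "(\<integral>x. f x \<partial>lborel) = 0"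
    and box: "\<And>c d. (LINT x:box c d|lborel. f x) = 0"
  shows "AE x in lborel. f x = 0"
proof -
  have borel: "sets lborel = sigma_sets UNIV (range (\<lambda>(c, d). box c d :: 'a set))"
    by (simp add: borel_eq_box)
  have stable: "Int_stable (range (\<lambda>(c, d). box c d :: 'a set))"
    by (auto simp: Int_stable_def box_Int_box)
  have Pow_top_sub: "range (\<lambda>(c, d). box c d :: 'a set) \<subseteq> Pow UNIV" by simp
  have si: "set_integrable lborel A f" if "A \<in> sets lborel" for A
    unfolding set_integrable_def using f that integrable_mult_indicator by blast
  have "(LINT x:A|lborel. f x) = 0" if "A \<in> sets lborel" for A
    using stable Pow_top_sub that[unfolded borel]
  proof (induction rule: sigma_sets_induct_disjoint)
    case (compl A)
    then have A: "A \<in> sets lborel" by (simp only: borel)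
    have "(LINT x:A \<union> (UNIV - A)|lborel. f x) = (LINT x:A|lborel. f x) + (LINT x:UNIV - A|lborel. f x)"
      using A by (intro set_integral_Un si) auto
    then show ?case using compl zero by (simp add: set_lebesgue_integral_def)
  next
    case (union A)
    then have A: "A i \<in> sets lborel" for i by (auto simp only: borel)
    have "(LINT x:(\<Union>i. A i)|lborel. f x) = (\<Sum>i. LINT x:A i|lborel. f x)"
      using union(1) A by (intro lebesgue_integral_countable_add si) (auto simp: disjoint_family_on_def)
    with union show ?case by simp
  qed (use box in \<open>auto simp: set_lebesgue_integral_def\<close>)
  then show ?thesis
    using density_unique_real[OF f, of "\<lambda>x. 0"] by simp
qed

text \<open>
  The fundamental lemma of the calculus of variations. On a closed box inside \<open>\<Omega>\<close> all integrals
  over subboxes vanish, hence so does the function; countably many such boxes cover the open set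
  \<open>\<Omega>\<close>.
\<close>

lemma L2_on_eq_0:
  assumes "open \<Omega>" and G: "G \<in> L2_on \<Omega>"
    and orth: "\<And>\<psi>. test_fun \<Omega> \<psi> \<Longrightarrow> inner G (abs_L2 \<psi>) = 0"
  shows "G = 0"
proof -
  obtain g where g: "sq_integrable g" and gb [measurable]: "g \<in> borel_measurable borel" and Gg: "G = abs_L2 g"
    using L2_borel_representative by blast
  have orth': "(\<integral>x. g x * \<psi> x \<partial>lebesgue) = 0" if "test_fun \<Omega> \<psi>" for \<psi>
    using orth[OF that] inner_abs_L2[OF g test_fun_sq_integrable[OF that]] Gg by simp
  have in_box: "AE x in lborel. x \<in> box a b \<longrightarrow> g x = 0" if ab: "cbox a b \<subseteq> \<Omega>" for a b
  proof -
    have sub: "(\<integral>x. indicator (box c d \<inter> box a b) x * g x \<partial>lborel) = 0" for c d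
    proof -
      obtain p q where pq: "box c d \<inter> box a b = box p q" unfolding box_Int_box by blast
      show ?thesis
      proof (cases "box p q = {}")
        case False
        have "box p q \<subseteq> box a b" using pq by blast
        then have "closure (box p q) \<subseteq> closure (box a b)" by (rule closure_mono)
        moreover have "box a b \<noteq> {}" using pq False by blast
        ultimately have "cbox p q \<subseteq> \<Omega>" using False ab by simp
        then have "(\<integral>x. indicator (box p q) x * g x \<partial>lebesgue) = 0"
          by (rule integral_box_eq_0[OF g]) (rule orth')
        then show ?thesis
          unfolding pq by (subst (asm) integral_completion) auto
      qed (simp add: pq)
    qed
    have "integrable lebesgue (\<lambda>x. indicator (cbox a b) x * g x)"
      by (intro sq_integrable_mult sq_integrable_indicator_cbox g)
    then have "integrable lborel (\<lambda>x. indicator (cbox a b) x * g x)"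
      by (subst (asm) integrable_completion) auto
    from integrable_mult_indicator[OF _ this, of "box a b"]
    have "integrable lborel (\<lambda>x. indicator (box a b) x * (indicator (cbox a b) x * g x))" by simp
    moreover have "(\<lambda>x. indicator (box a b) x * (indicator (cbox a b) x * g x))
        = (\<lambda>x. indicator (box a b) x * g x)"
      using box_subset_cbox[of a b] by (auto simp: fun_eq_iff split: split_indicator)
    ultimately have "AE x in lborel. indicator (box a b) x * g x = 0"
      using sub[of a b] sub
      by (intro AE_zero_if_box_integrals_zero) (auto simp: set_lebesgue_integral_def indicator_inter_arith mult.assoc)
    then show ?thesis by eventually_elim (auto split: split_indicator_asm)
  qed
  \<comment> \<open>the boundary of a box is a null set\<close>
  have in_cbox: "AE x in lebesgue. x \<in> cbox a b \<longrightarrow> g x = 0" if "cbox a b \<subseteq> \<Omega>" for a b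
  proof -
    have "AE x in lebesgue. x \<notin> cbox a b - box a b"
      using negligible_frontier_interval[of a b] unfolding negligible_iff_null_sets by (rule AE_not_in)
    with AE_completion[OF in_box[OF that]] show ?thesis by eventually_elim auto
  qed
  obtain \<D> where \<D>: "countable \<D>" "\<D> \<subseteq> Pow \<Omega>" "\<And>X. X \<in> \<D> \<Longrightarrow> \<exists>a b. X = cbox a b" "\<Union>\<D> = \<Omega>"
    using open_countable_Union_open_cbox[OF \<open>open \<Omega>\<close>] by metis
  have "AE x in lebesgue. \<forall>X\<in>\<D>. x \<in> X \<longrightarrow> g x = 0"
  proof (subst AE_ball_countable[OF \<D>(1)], rule ballI)
    fix X assume X: "X \<in> \<D>"
    then obtain a b where "X = cbox a b" using \<D>(3) by blast
    then show "AE x in lebesgue. x \<in> X \<longrightarrow> g x = 0" using in_cbox[of a b] X \<D>(2) by blast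
  qed
  moreover have "AE x in lebesgue. x \<notin> \<Omega> \<longrightarrow> g x = 0"
    using G unfolding L2_on_def Gg by (simp add: vanishes_outside_abs_L2[OF g])
  ultimately have "AE x in lebesgue. g x = 0"
  proof eventually_elim
    case (elim x)
    then show ?case using \<D>(4) by (cases "x \<in> \<Omega>") auto
  qed
  then have "abs_L2 g = abs_L2 (\<lambda>x. 0)" by (intro abs_L2_eqI g sq_integrable_zero)
  then show ?thesis by (simp add: Gg zero_L2_def)
qed


lemma subspace_L2_on: "subspace (L2_on \<Omega>)"
proof (rule subspaceI)
  show "0 \<in> L2_on \<Omega>" unfolding L2_on_def by simp (transfer, simp)
  show "g + h \<in> L2_on \<Omega>" if "g \<in> L2_on \<Omega>" "h \<in> L2_on \<Omega>" for g h
    using that unfolding L2_on_def mem_Collect_eq by transfer (auto elim: eventually_elim2)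
  show "c *\<^sub>R g \<in> L2_on \<Omega>" if "g \<in> L2_on \<Omega>" for c g
    using that unfolding L2_on_def mem_Collect_eq by transfer (auto elim: eventually_mono)
qed

lemma is_weak_deriv_add:
  "is_weak_deriv \<Omega> b g G \<Longrightarrow> is_weak_deriv \<Omega> b h H \<Longrightarrow> is_weak_deriv \<Omega> b (g + h) (G + H)"
  unfolding is_weak_deriv_def by (auto simp: subspace_add[OF subspace_L2_on] inner_add_left)

lemma is_weak_deriv_scaleR:
  "is_weak_deriv \<Omega> b g G \<Longrightarrow> is_weak_deriv \<Omega> b (c *\<^sub>R g) (c *\<^sub>R G)"
  unfolding is_weak_deriv_def by (auto simp: subspace_scale[OF subspace_L2_on])

lemma weak_deriv_eq:
  assumes "open \<Omega>" and G: "is_weak_deriv \<Omega> b g G"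
  shows "weak_deriv \<Omega> b g = G"
  unfolding weak_deriv_def
proof (rule the_equality, rule G)
  fix H assume H: "is_weak_deriv \<Omega> b g H"
  have "H - G = 0"
    using G H by (intro L2_on_eq_0[OF \<open>open \<Omega>\<close>])
      (auto simp: is_weak_deriv_def subspace_diff[OF subspace_L2_on] inner_diff_left)
  then show "H = G" by simp
qed

lemma is_weak_deriv_weak_deriv:
  "open \<Omega> \<Longrightarrow> g \<in> H1 \<Omega> \<Longrightarrow> b \<in> Basis \<Longrightarrow> is_weak_deriv \<Omega> b g (weak_deriv \<Omega> b g)"
  unfolding H1_def by (auto simp: weak_deriv_eq)

lemma subspace_H1: "subspace (H1 \<Omega>)"
proof (rule subspaceI)
  have "is_weak_deriv \<Omega> b 0 0" for b
    by (simp add: is_weak_deriv_def subspace_0[OF subspace_L2_on])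
  then show "0 \<in> H1 \<Omega>" unfolding H1_def using subspace_0[OF subspace_L2_on] by blast
  show "g + h \<in> H1 \<Omega>" if "g \<in> H1 \<Omega>" "h \<in> H1 \<Omega>" for g h
  proof -
    have "\<exists>G. is_weak_deriv \<Omega> b (g + h) G" if b: "b \<in> Basis" for b
    proof -
      obtain G H where "is_weak_deriv \<Omega> b g G" "is_weak_deriv \<Omega> b h H"
        using \<open>g \<in> H1 \<Omega>\<close> \<open>h \<in> H1 \<Omega>\<close> b unfolding H1_def by blast
      from is_weak_deriv_add[OF this] show ?thesis ..
    qed
    with that show ?thesis by (simp add: H1_def subspace_add[OF subspace_L2_on])
  qed
  show "c *\<^sub>R g \<in> H1 \<Omega>" if "g \<in> H1 \<Omega>" for c g
  proof -
    have "\<exists>G. is_weak_deriv \<Omega> b (c *\<^sub>R g) G" if b: "b \<in> Basis" for b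
    proof -
      obtain G where "is_weak_deriv \<Omega> b g G"
        using \<open>g \<in> H1 \<Omega>\<close> b unfolding H1_def by blast
      from is_weak_deriv_scaleR[OF this] show ?thesis ..
    qed
    with that show ?thesis by (simp add: H1_def subspace_scale[OF subspace_L2_on])
  qed
qed

lemma grad_inner_commute: "grad_inner \<Omega> g h = grad_inner \<Omega> h g"
  by (simp add: grad_inner_def inner_commute)

lemma grad_inner_self_nonneg: "0 \<le> grad_inner \<Omega> g g"
  by (simp add: grad_inner_def sum_nonneg)

lemma grad_inner_add_left:
  assumes "open \<Omega>" "g \<in> H1 \<Omega>" "h \<in> H1 \<Omega>"
  shows "grad_inner \<Omega> (g + h) k = grad_inner \<Omega> g k + grad_inner \<Omega> h k"
proof -
  have "weak_deriv \<Omega> b (g + h) = weak_deriv \<Omega> b g + weak_deriv \<Omega> b h" if "b \<in> Basis" for b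
    using that assms by (intro weak_deriv_eq is_weak_deriv_add is_weak_deriv_weak_deriv)
  then show ?thesis by (simp add: grad_inner_def inner_add_left sum.distrib)
qed

lemma grad_inner_scaleR_left:
  assumes "open \<Omega>" "g \<in> H1 \<Omega>"
  shows "grad_inner \<Omega> (c *\<^sub>R g) k = c * grad_inner \<Omega> g k"
proof -
  have "weak_deriv \<Omega> b (c *\<^sub>R g) = c *\<^sub>R weak_deriv \<Omega> b g" if "b \<in> Basis" for b
    using that assms by (intro weak_deriv_eq is_weak_deriv_scaleR is_weak_deriv_weak_deriv)
  then show ?thesis by (simp add: grad_inner_def sum_distrib_left)
qed

text \<open>
  Used with the coordinate function \<open>x \<bullet> b\<close> for \<open>m\<close>, which is bounded on a bounded domain.
\<close>

lemma norm_abs_L2_mult_le: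
  assumes h: "sq_integrable h" "\<And>x. x \<notin> \<Omega> \<Longrightarrow> h x = 0"
    and mh: "sq_integrable (\<lambda>x. m x * h x)" and m: "\<And>x. x \<in> \<Omega> \<Longrightarrow> \<bar>m x\<bar> \<le> R" and "0 \<le> R"
  shows "norm (abs_L2 (\<lambda>x. m x * h x)) \<le> R * norm (abs_L2 h)"
proof -
  have "(\<integral>x. (m x * h x) * (m x * h x) \<partial>lebesgue) \<le> (\<integral>x. R\<^sup>2 * (h x * h x) \<partial>lebesgue)"
  proof (rule integral_mono)
    show "integrable lebesgue (\<lambda>x. (m x * h x) * (m x * h x))" by (rule sq_integrable_mult[OF mh mh])
    show "integrable lebesgue (\<lambda>x. R\<^sup>2 * (h x * h x))" using sq_integrable_mult[OF h(1) h(1)] by simp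
    fix x
    show "(m x * h x) * (m x * h x) \<le> R\<^sup>2 * (h x * h x)"
    proof (cases "x \<in> \<Omega>")
      case True
      have "(m x)\<^sup>2 \<le> R\<^sup>2" using m[OF True] by (rule power2_le_iff_abs_le[THEN iffD2, OF \<open>0 \<le> R\<close>])
      then have "(m x)\<^sup>2 * (h x)\<^sup>2 \<le> R\<^sup>2 * (h x)\<^sup>2" by (rule mult_right_mono) simp
      then show ?thesis by (simp add: power2_eq_square algebra_simps)
    qed (simp add: h(2))
  qed
  then have "(norm (abs_L2 (\<lambda>x. m x * h x)))\<^sup>2 \<le> (R * norm (abs_L2 h))\<^sup>2"
    by (simp add: power_mult_distrib power2_norm_eq_inner inner_abs_L2 mh h(1))
  then show ?thesis by (rule power2_le_imp_le) (simp add: \<open>0 \<le> R\<close>)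
qed

text \<open>
  Let \<open>\<psi>\<^sub>k\<close> be test functions converging to \<open>g\<close> in \<open>H\<^sup>1\<close>. Since \<open>\<nabla>g = 0\<close>, the derivatives
  \<open>\<partial>\<^sub>b \<psi>\<^sub>k\<close> tend to \<open>0\<close>. Also \<open>g\<close> is orthogonal to every derivative of a test function, in
  particular to \<open>\<partial>\<^sub>b (x\<^sub>b \<psi>\<^sub>k) = \<psi>\<^sub>k + x\<^sub>b \<partial>\<^sub>b \<psi>\<^sub>k\<close>. In the limit \<open>g\<close> is orthogonal to itself.
\<close>

lemma grad_inner_definite:
  assumes "open \<Omega>" "bounded \<Omega>" "g \<in> H01 \<Omega>" and zero: "grad_inner \<Omega> g g = 0"
  shows "g = 0"
proof -
  obtain \<psi> where \<psi>: "test_fun \<Omega> (\<psi> k)" and lim: "(\<lambda>k. H1_norm \<Omega> (abs_L2 (\<psi> k) - g)) \<longlonglongrightarrow> 0" for k :: nat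
    using assms(3) unfolding H01_def by blast
  have gH: "g \<in> H1 \<Omega>" using assms(3) unfolding H01_def by blast
  define b :: 'a where "b = (SOME i. i \<in> Basis)"
  have b: "b \<in> Basis" unfolding b_def by (rule SOME_Basis)
  have "weak_deriv \<Omega> b g = 0"
    using zero b unfolding grad_inner_def by (subst (asm) sum_nonneg_eq_0_iff) auto
  with is_weak_deriv_weak_deriv[OF assms(1) gH b] have wg: "is_weak_deriv \<Omega> b g 0" by simp
  define d where "d k = partial_deriv b (\<psi> k)" for k
  have d: "test_fun \<Omega> (d k)" for k unfolding d_def by (rule test_fun_partial_deriv[OF \<psi> b])
  have wd: "weak_deriv \<Omega> b (abs_L2 (\<psi> k) - g) = abs_L2 (d k)" for k
    using is_weak_deriv_add[OF is_weak_deriv_test_fun[OF \<psi> b] is_weak_deriv_scaleR[OF wg, of "-1"]]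
    by (intro weak_deriv_eq[OF assms(1)]) (simp add: d_def)
  have le1: "norm (abs_L2 (\<psi> k) - g) \<le> H1_norm \<Omega> (abs_L2 (\<psi> k) - g)" for k
    unfolding H1_norm_def by (rule real_le_rsqrt) simp
  have le2: "norm (abs_L2 (d k)) \<le> H1_norm \<Omega> (abs_L2 (\<psi> k) - g)" for k
  proof -
    let ?e = "abs_L2 (\<psi> k) - g"
    have "(norm (abs_L2 (d k)))\<^sup>2 = inner (weak_deriv \<Omega> b ?e) (weak_deriv \<Omega> b ?e)"
      by (simp add: wd power2_norm_eq_inner)
    also have "\<dots> \<le> grad_inner \<Omega> ?e ?e"
      unfolding grad_inner_def by (rule member_le_sum[OF b]) auto
    also have "\<dots> \<le> (norm ?e)\<^sup>2 + (grad_norm \<Omega> ?e)\<^sup>2"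
      by (simp add: grad_norm_def grad_inner_self_nonneg)
    finally show ?thesis unfolding H1_norm_def by (rule real_le_rsqrt)
  qed
  have \<psi>_lim: "(\<lambda>k. abs_L2 (\<psi> k)) \<longlonglongrightarrow> g"
    by (rule LIM_zero_cancel, rule tendsto_norm_zero_cancel, rule tendsto_sandwich[OF _ _ tendsto_const lim])
      (auto simp: le1)
  have d_lim: "(\<lambda>k. norm (abs_L2 (d k))) \<longlonglongrightarrow> 0"
    by (rule tendsto_sandwich[OF _ _ tendsto_const lim]) (auto simp: le2)
  obtain R where R: "\<And>x. x \<in> \<Omega> \<Longrightarrow> norm x \<le> R" "0 < R"
    using assms(2) unfolding bounded_pos by blast
  have key: "\<bar>inner g (abs_L2 (\<psi> k))\<bar> \<le> norm g * (R * norm (abs_L2 (d k)))" for k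
  proof -
    have sm: "smooth_fun (\<psi> k)" using \<psi> unfolding test_fun_def by blast
    have t1: "test_fun \<Omega> (\<lambda>x. (x \<bullet> b) * \<psi> k x)" and t2: "test_fun \<Omega> (\<lambda>x. (x \<bullet> b) * d k x)"
      by (rule test_fun_mult[OF smooth_fun_coord \<psi>], rule test_fun_mult[OF smooth_fun_coord d])
    note sq = test_fun_sq_integrable[OF \<psi>] test_fun_sq_integrable[OF d] test_fun_sq_integrable[OF t2]
    have "partial_deriv b (\<lambda>x. (x \<bullet> b) * \<psi> k x) = (\<lambda>x. (x \<bullet> b) * d k x + \<psi> k x)"
      using b by (auto simp: fun_eq_iff d_def partial_deriv_coord
          partial_deriv_mult[OF smooth_fun_differentiable[OF smooth_fun_coord] smooth_fun_differentiable[OF sm]])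
    moreover have "abs_L2 (\<lambda>x. (x \<bullet> b) * d k x + \<psi> k x) = abs_L2 (\<lambda>x. (x \<bullet> b) * d k x) + abs_L2 (\<psi> k)"
      using sq by (simp add: plus_L2.abs_eq)
    ultimately have "inner g (abs_L2 (\<lambda>x. (x \<bullet> b) * d k x) + abs_L2 (\<psi> k)) = 0"
      using wg t1 unfolding is_weak_deriv_def by fastforce
    then have "\<bar>inner g (abs_L2 (\<psi> k))\<bar> = \<bar>inner g (abs_L2 (\<lambda>x. (x \<bullet> b) * d k x))\<bar>"
      by (simp add: inner_add_right)
    also have "\<dots> \<le> norm g * norm (abs_L2 (\<lambda>x. (x \<bullet> b) * d k x))"
      by (rule Cauchy_Schwarz_ineq2)
    also have "norm (abs_L2 (\<lambda>x. (x \<bullet> b) * d k x)) \<le> R * norm (abs_L2 (d k))"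
    proof (rule norm_abs_L2_mult_le[OF sq(2) _ sq(3)])
      show "d k x = 0" if "x \<notin> \<Omega>" for x using d[of k] that unfolding test_fun_def by blast
      show "\<bar>x \<bullet> b\<bar> \<le> R" if "x \<in> \<Omega>" for x
        using Basis_le_norm[OF b, of x] R(1)[OF that] by linarith
    qed (use R in simp)
    finally show ?thesis by (simp add: mult_left_mono)
  qed
  have "(\<lambda>k. \<bar>inner g (abs_L2 (\<psi> k))\<bar>) \<longlonglongrightarrow> 0"
  proof (rule tendsto_sandwich[OF _ _ tendsto_const])
    show "(\<lambda>k. norm g * (R * norm (abs_L2 (d k)))) \<longlonglongrightarrow> 0"
      by (intro tendsto_mult_right_zero d_lim)
  qed (auto simp: key)
  moreover have "(\<lambda>k. \<bar>inner g (abs_L2 (\<psi> k))\<bar>) \<longlonglongrightarrow> \<bar>inner g g\<bar>"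
    by (intro tendsto_intros \<psi>_lim)
  ultimately have "\<bar>inner g g\<bar> = 0" using LIMSEQ_unique by blast
  then show ?thesis by simp
qed

section \<open>Galerkin approximation in an abstract inner product space\<close>

text \<open>
  A square matrix with orthonormal rows has orthonormal columns: with \<open>P = A\<^sup>T A\<close>, the squared
  Frobenius norm of \<open>P - I\<close> is \<open>tr (P\<^sup>2) - 2 tr P + tr I\<close>, and all three traces equal the size of
  the matrix because \<open>A A\<^sup>T = I\<close>.
\<close>

lemma orthonormal_columns_if_rows:
  fixes A :: "'i \<Rightarrow> 'j \<Rightarrow> real"
  assumes fin: "finite I" "finite J" and card: "card I = card J"
    and rows: "\<And>i l. i \<in> I \<Longrightarrow> l \<in> I \<Longrightarrow> (\<Sum>j\<in>J. A i j * A l j) = (if i = l then 1 else 0)"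
    and jk: "j \<in> J" "k \<in> J"
  shows "(\<Sum>i\<in>I. A i j * A i k) = (if j = k then 1 else 0)"
proof -
  define P where "P j k = (\<Sum>i\<in>I. A i j * A i k)" for j k
  define \<delta> :: "'j \<Rightarrow> 'j \<Rightarrow> real" where "\<delta> j k = (if j = k then 1 else 0)" for j k
  have "(\<Sum>j\<in>J. \<Sum>k\<in>J. (P j k)\<^sup>2)
      = (\<Sum>j\<in>J. \<Sum>k\<in>J. \<Sum>i\<in>I. \<Sum>l\<in>I. (A i j * A l j) * (A i k * A l k))"
    by (simp add: P_def power2_eq_square sum_product algebra_simps)
  also have "\<dots> = (\<Sum>i\<in>I. \<Sum>l\<in>I. \<Sum>j\<in>J. \<Sum>k\<in>J. (A i j * A l j) * (A i k * A l k))"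
  proof -
    have "(\<Sum>j\<in>J. \<Sum>k\<in>J. \<Sum>i\<in>I. \<Sum>l\<in>I. F i j l k) = (\<Sum>i\<in>I. \<Sum>l\<in>I. \<Sum>j\<in>J. \<Sum>k\<in>J. F i j l k)"
      for F :: "'i \<Rightarrow> 'j \<Rightarrow> 'i \<Rightarrow> 'j \<Rightarrow> real"
      unfolding sum.cartesian_product
      by (rule sum.reindex_bij_witness[of _ "\<lambda>(i, l, j, k). (j, k, i, l)" "\<lambda>(j, k, i, l). (i, l, j, k)"]) auto
    then show ?thesis .
  qed
  also have "\<dots> = (\<Sum>i\<in>I. \<Sum>l\<in>I. (\<Sum>j\<in>J. A i j * A l j) * (\<Sum>k\<in>J. A i k * A l k))"
    by (simp add: sum_product)
  also have "\<dots> = (\<Sum>i\<in>I. \<Sum>l\<in>I. if i = l then 1 else 0)"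
    by (intro sum.cong refl) (simp add: rows)
  also have "\<dots> = card J" using fin card by simp
  finally have PP: "(\<Sum>j\<in>J. \<Sum>k\<in>J. (P j k)\<^sup>2) = card J" .
  have "(\<Sum>j\<in>J. \<Sum>k\<in>J. P j k * \<delta> j k) = (\<Sum>j\<in>J. \<Sum>k\<in>J. if j = k then P j k else 0)"
    by (intro sum.cong refl) (simp add: \<delta>_def)
  also have "\<dots> = (\<Sum>j\<in>J. P j j)" using fin by simp
  also have "\<dots> = (\<Sum>i\<in>I. \<Sum>j\<in>J. A i j * A i j)" unfolding P_def by (rule sum.swap)
  also have "\<dots> = card J" using rows card by simp
  finally have P\<delta>: "(\<Sum>j\<in>J. \<Sum>k\<in>J. P j k * \<delta> j k) = card J" .
  have "(\<Sum>j\<in>J. \<Sum>k\<in>J. (\<delta> j k)\<^sup>2) = (\<Sum>j\<in>J. \<Sum>k\<in>J. if j = k then 1 else 0)"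
    by (intro sum.cong refl) (simp add: \<delta>_def)
  also have "\<dots> = card J" using fin by simp
  finally have \<delta>\<delta>: "(\<Sum>j\<in>J. \<Sum>k\<in>J. (\<delta> j k)\<^sup>2) = card J" .
  have "(\<Sum>j\<in>J. \<Sum>k\<in>J. (P j k - \<delta> j k)\<^sup>2) = (\<Sum>j\<in>J. \<Sum>k\<in>J. (P j k)\<^sup>2)
      + (\<Sum>j\<in>J. \<Sum>k\<in>J. (\<delta> j k)\<^sup>2) - 2 * (\<Sum>j\<in>J. \<Sum>k\<in>J. P j k * \<delta> j k)"
    by (simp add: power2_diff sum.distrib sum_subtractf sum_distrib_left mult.assoc)
  also have "\<dots> = 0" by (simp add: PP P\<delta> \<delta>\<delta>)
  finally have "(\<Sum>k\<in>J. (P j k - \<delta> j k)\<^sup>2) = 0"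
    using fin jk by (subst (asm) sum_nonneg_eq_0_iff) (auto intro: sum_nonneg)
  then have "(P j k - \<delta> j k)\<^sup>2 = 0"
    using fin jk by (subst (asm) sum_nonneg_eq_0_iff) auto
  then show ?thesis by (simp add: P_def \<delta>_def)
qed

text \<open>
  The laws are only required on a subspace, since the gradient form is bilinear only where weak
  derivatives exist. Besides the gradient form itself, the form of the projection errors
  (\<open>res_form\<close> below) is an instance, which is only semidefinite.
\<close>

locale semi_inner =
  fixes V :: "'v::real_vector set" and a :: "'v \<Rightarrow> 'v \<Rightarrow> real"
  assumes V: "subspace V"
    and commute: "x \<in> V \<Longrightarrow> y \<in> V \<Longrightarrow> a x y = a y x"
    and add_left: "x \<in> V \<Longrightarrow> y \<in> V \<Longrightarrow> z \<in> V \<Longrightarrow> a (x + y) z = a x z + a y z"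
    and scale_left: "x \<in> V \<Longrightarrow> z \<in> V \<Longrightarrow> a (c *\<^sub>R x) z = c * a x z"
    and nonneg: "x \<in> V \<Longrightarrow> 0 \<le> a x x"
begin

lemmas V_closed = subspace_0[OF V] subspace_add[OF V] subspace_diff[OF V] subspace_scale[OF V]
  subspace_neg[OF V] subspace_sum[OF V]

lemma add_right: "x \<in> V \<Longrightarrow> y \<in> V \<Longrightarrow> z \<in> V \<Longrightarrow> a z (x + y) = a z x + a z y"
  using add_left commute V_closed by metis

lemma scale_right: "x \<in> V \<Longrightarrow> z \<in> V \<Longrightarrow> a z (c *\<^sub>R x) = c * a z x"
  using scale_left commute V_closed by metis

lemma zero_left: "z \<in> V \<Longrightarrow> a 0 z = 0"
  using scale_left[of 0 z 0] V_closed by simp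

lemma diff_left: "x \<in> V \<Longrightarrow> y \<in> V \<Longrightarrow> z \<in> V \<Longrightarrow> a (x - y) z = a x z - a y z"
  using add_left[of x "(-1) *\<^sub>R y" z] scale_left[of y z "-1"] by (simp add: V_closed)

lemma diff_right: "x \<in> V \<Longrightarrow> y \<in> V \<Longrightarrow> z \<in> V \<Longrightarrow> a z (x - y) = a z x - a z y"
  using diff_left commute V_closed by metis

lemma sum_left:
  "finite I \<Longrightarrow> (\<And>i. i \<in> I \<Longrightarrow> x i \<in> V) \<Longrightarrow> z \<in> V \<Longrightarrow> a (\<Sum>i\<in>I. x i) z = (\<Sum>i\<in>I. a (x i) z)"
  by (induction I rule: finite_induct) (auto simp: zero_left add_left V_closed)

lemma sum_right:
  "finite I \<Longrightarrow> (\<And>i. i \<in> I \<Longrightarrow> x i \<in> V) \<Longrightarrow> z \<in> V \<Longrightarrow> a z (\<Sum>i\<in>I. x i) = (\<Sum>i\<in>I. a z (x i))"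
  using sum_left[of I x z] commute by (simp add: V_closed)

lemma add_self_le:
  assumes "x \<in> V" "y \<in> V"
  shows "a (x + y) (x + y) \<le> 2 * a x x + 2 * a y y"
  using nonneg[of "x - y"] assms commute[of x y]
  by (simp add: V_closed add_left add_right diff_left diff_right)

lemma diff_self_le:
  assumes "x \<in> V" "y \<in> V"
  shows "a (x - y) (x - y) \<le> 2 * a x x + 2 * a y y"
  using nonneg[of "x + y"] assms commute[of x y]
  by (simp add: V_closed add_left add_right diff_left diff_right)

lemma sum_self_expand:
  assumes "finite I" and x: "\<And>i. i \<in> I \<Longrightarrow> x i \<in> V"
  shows "a (\<Sum>i\<in>I. x i) (\<Sum>i\<in>I. x i) = (\<Sum>i\<in>I. \<Sum>j\<in>I. a (x i) (x j))"
proof -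
  have "a (\<Sum>i\<in>I. x i) (\<Sum>i\<in>I. x i) = (\<Sum>i\<in>I. a (x i) (\<Sum>i\<in>I. x i))"
    by (rule sum_left) (use assms in \<open>auto simp: V_closed\<close>)
  also have "\<dots> = (\<Sum>i\<in>I. \<Sum>j\<in>I. a (x i) (x j))"
    by (intro sum.cong refl sum_right) (use assms in auto)
  finally show ?thesis .
qed

text \<open>
  The Cauchy-Schwarz inequality for sums, here from
  \<open>2 a(x\<^sub>i, x\<^sub>j) \<le> a(x\<^sub>i, x\<^sub>i) + a(x\<^sub>j, x\<^sub>j)\<close>.
\<close>

lemma sum_self_le:
  assumes I: "finite I" and x: "\<And>i. i \<in> I \<Longrightarrow> x i \<in> V"
  shows "a (\<Sum>i\<in>I. x i) (\<Sum>i\<in>I. x i) \<le> card I * (\<Sum>i\<in>I. a (x i) (x i))"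
proof -
  have "a (\<Sum>i\<in>I. x i) (\<Sum>i\<in>I. x i) = (\<Sum>i\<in>I. \<Sum>j\<in>I. a (x i) (x j))"
    by (rule sum_self_expand[OF assms])
  also have "\<dots> \<le> (\<Sum>i\<in>I. \<Sum>j\<in>I. (a (x i) (x i) + a (x j) (x j)) / 2)"
  proof (intro sum_mono)
    fix i j assume "i \<in> I" "j \<in> I"
    then show "a (x i) (x j) \<le> (a (x i) (x i) + a (x j) (x j)) / 2"
      using nonneg[of "x i - x j"] x commute[of "x i" "x j"]
      by (simp add: V_closed diff_left diff_right)
  qed
  also have "\<dots> = card I * (\<Sum>i\<in>I. a (x i) (x i))"
    by (simp add: add_divide_distrib sum.distrib sum_distrib_left sum_divide_distrib[symmetric])
  finally show ?thesis .
qed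

text \<open>
  Independence of the Hilbert-Schmidt norm from the basis. In \<open>\<real>\<^sup>J\<close> with weights \<open>w\<close>, let \<open>K\<close> map
  \<open>c\<close> to \<open>\<Sum>\<^sub>j w\<^sub>j c\<^sub>j x\<^sub>j\<close>. The left side sums the squared length of \<open>K g\<^sub>i\<close> over the orthonormal
  basis \<open>g\<close>, the right side over the scaled unit vectors. Both agree because the matrix
  \<open>sqrt w\<^sub>j g\<^sub>i\<^sub>j\<close> has orthonormal columns as well as rows.
\<close>

lemma sum_self_orthonormal:
  fixes w :: "'j \<Rightarrow> real" and g :: "'i \<Rightarrow> 'j \<Rightarrow> real"
  assumes fin: "finite I" "finite J" "card I = card J"
    and w: "\<And>j. j \<in> J \<Longrightarrow> 0 < w j"
    and g: "\<And>i l. i \<in> I \<Longrightarrow> l \<in> I \<Longrightarrow> (\<Sum>j\<in>J. w j * (g i j * g l j)) = (if i = l then 1 else 0)"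
    and x: "\<And>j. j \<in> J \<Longrightarrow> x j \<in> V"
  shows "(\<Sum>i\<in>I. a (\<Sum>j\<in>J. (w j * g i j) *\<^sub>R x j) (\<Sum>j\<in>J. (w j * g i j) *\<^sub>R x j))
    = (\<Sum>j\<in>J. w j * a (x j) (x j))"
proof -
  define A where "A i j = sqrt (w j) * g i j" for i j
  have A: "w j * g i j = sqrt (w j) * A i j" if "j \<in> J" for i j
    using w[OF that] by (simp add: A_def real_sqrt_mult_self less_imp_le)
  have "(\<Sum>j\<in>J. A i j * A l j) = (\<Sum>j\<in>J. w j * (g i j * g l j))" for i l
    by (intro sum.cong refl) (simp add: A_def w less_imp_le algebra_simps flip: power2_eq_square)
  then have AA: "(\<Sum>i\<in>I. A i j * A i k) = (if j = k then 1 else 0)" if "j \<in> J" "k \<in> J" for j k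
    using orthonormal_columns_if_rows[OF fin _ that, of A] g by simp
  have "(\<Sum>i\<in>I. a (\<Sum>j\<in>J. (w j * g i j) *\<^sub>R x j) (\<Sum>j\<in>J. (w j * g i j) *\<^sub>R x j))
      = (\<Sum>i\<in>I. \<Sum>j\<in>J. \<Sum>k\<in>J. (sqrt (w j) * A i j) * ((sqrt (w k) * A i k) * a (x j) (x k)))"
    using fin x by (intro sum.cong refl, subst sum_self_expand)
      (auto simp: V_closed scale_left scale_right A intro!: sum.cong)
  also have "\<dots> = (\<Sum>j\<in>J. \<Sum>i\<in>I. \<Sum>k\<in>J. (sqrt (w j) * A i j) * ((sqrt (w k) * A i k) * a (x j) (x k)))"
    by (rule sum.swap)
  also have "\<dots> = (\<Sum>j\<in>J. \<Sum>k\<in>J. \<Sum>i\<in>I. (sqrt (w j) * A i j) * ((sqrt (w k) * A i k) * a (x j) (x k)))"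
    by (intro sum.cong refl sum.swap)
  also have "\<dots> = (\<Sum>j\<in>J. \<Sum>k\<in>J. (sqrt (w j) * sqrt (w k) * a (x j) (x k)) * (\<Sum>i\<in>I. A i j * A i k))"
    by (simp add: sum_distrib_left algebra_simps)
  also have "\<dots> = (\<Sum>j\<in>J. \<Sum>k\<in>J. if j = k then sqrt (w j) * sqrt (w k) * a (x j) (x k) else 0)"
    by (intro sum.cong refl) (simp add: AA)
  also have "\<dots> = (\<Sum>j\<in>J. w j * a (x j) (x j))"
    using fin w by (intro sum.cong refl) (simp add: less_imp_le)
  finally show ?thesis .
qed

end

locale inner_form = semi_inner V a for V :: "'v::real_vector set" and a +
  assumes definite: "x \<in> V \<Longrightarrow> a x x = 0 \<Longrightarrow> x = 0"
begin

lemma span_subset: "B \<subseteq> V \<Longrightarrow> span B \<subseteq> V"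
  by (rule span_minimal[OF _ V])

text \<open>
  Gram-Schmidt: the component \<open>c\<close> of a new vector orthogonal to the previous span adds the term
  \<open>(a(x, c) / a(c, c)) c\<close> to the projection.
\<close>

lemma orthogonal_projection_exists:
  assumes "finite B" "B \<subseteq> V" "x \<in> V"
  shows "\<exists>p\<in>span B. \<forall>v\<in>span B. a (x - p) v = 0"
  using assms
proof (induction B arbitrary: x rule: finite_induct)
  case empty
  then show ?case using commute[of x 0] zero_left by (auto simp: V_closed)
next
  case (insert b B)
  from insert have bV: "b \<in> V" "B \<subseteq> V" by auto
  note sV = subsetD[OF span_subset[OF bV(2)]]
  obtain q where q: "q \<in> span B" "\<And>v. v \<in> span B \<Longrightarrow> a (b - q) v = 0"
    using insert.IH[OF bV(2) bV(1)] by blast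
  obtain p where p: "p \<in> span B" "\<And>v. v \<in> span B \<Longrightarrow> a (x - p) v = 0"
    using insert.IH[OF bV(2) insert.prems(2)] by blast
  define c where "c = b - q"
  have cV: "c \<in> V" and pV: "p \<in> V" and xV: "x \<in> V"
    using bV sV q(1) p(1) insert.prems by (auto simp: c_def V_closed)
  have xpV: "x - p \<in> V" by (intro V_closed xV pV)
  \<comment> \<open>if \<open>c = 0\<close>, division by zero makes \<open>t = 0\<close>, and the old projection stays correct\<close>
  define t where "t = a (x - p) c / a c c"
  have q': "q \<in> span (insert b B)" and p': "p \<in> span (insert b B)"
    using span_mono[of B "insert b B"] q(1) p(1) by blast+
  have c': "c \<in> span (insert b B)" unfolding c_def by (intro span_diff q' span_base) simp
  have tc: "a (x - p - t *\<^sub>R c) c = 0"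
  proof (cases "a c c = 0")
    case True
    then have "c = 0" using definite cV by blast
    then show ?thesis using commute[of "x - p - t *\<^sub>R c" 0] xpV by (simp add: V_closed zero_left)
  next
    case False
    have "a (x - p - t *\<^sub>R c) c = a (x - p) c - t * a c c"
      using xpV cV by (simp add: diff_left[of "x - p" "t *\<^sub>R c"] V_closed scale_left)
    with False show ?thesis by (simp add: t_def)
  qed
  show ?case
  proof (rule bexI[of _ "p + t *\<^sub>R c"], rule ballI)
    fix v assume "v \<in> span (insert b B)"
    then obtain s where s: "v - s *\<^sub>R b \<in> span B" unfolding span_insert by blast
    define z where "z = v - s *\<^sub>R c"
    have "z = (v - s *\<^sub>R b) + s *\<^sub>R q" by (simp add: z_def c_def algebra_simps)
    then have z: "z \<in> span B" using s q(1) by (simp add: span_add span_scale)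
    have zV: "z \<in> V" using sV z by blast
    have yV: "x - p - t *\<^sub>R c \<in> V" by (intro V_closed xpV cV)
    have "a (x - p - t *\<^sub>R c) z = a (x - p) z - t * a c z"
      using xpV cV zV by (simp add: diff_left[of "x - p" "t *\<^sub>R c"] V_closed scale_left)
    also have "\<dots> = 0" using p(2)[OF z] q(2)[OF z] by (simp add: c_def)
    finally have "a (x - p - t *\<^sub>R c) (z + s *\<^sub>R c) = 0"
      using yV cV zV tc by (simp add: add_right V_closed scale_right)
    moreover have "z + s *\<^sub>R c = v" by (simp add: z_def)
    moreover have "x - p - t *\<^sub>R c = x - (p + t *\<^sub>R c)" by simp
    ultimately show "a (x - (p + t *\<^sub>R c)) v = 0" by metis
  qed (intro span_add span_scale p' c')
qed

end

locale galerkin_space = inner_form V a for V :: "'v::real_inner set" and a +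
  fixes W
  assumes W: "subspace W" "W \<subseteq> V" "\<exists>B. finite B \<and> W = span B"
begin

lemmas W_closed = subspace_0[OF W(1)] subspace_add[OF W(1)] subspace_diff[OF W(1)] subspace_scale[OF W(1)]
lemmas W_V = subsetD[OF W(2)]

definition ritz :: "'v \<Rightarrow> 'v" where
  "ritz x = (THE p. p \<in> W \<and> (\<forall>v\<in>W. a (x - p) v = 0))"

lemma ritz_eqI:
  assumes "x \<in> V" "p \<in> W" "\<And>v. v \<in> W \<Longrightarrow> a (x - p) v = 0"
  shows "ritz x = p"
  unfolding ritz_def
proof (rule the_equality)
  fix q assume q: "q \<in> W \<and> (\<forall>v\<in>W. a (x - q) v = 0)"
  have pq: "q - p \<in> W" using q assms by (auto simp: W_closed)
  have "a (q - p) (q - p) = a (x - p) (q - p) - a (x - q) (q - p)"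
    using pq q assms W_V by (simp add: diff_left V_closed)
  also have "\<dots> = 0" using q assms(3) pq by simp
  finally show "q = p" using definite[OF W_V[OF pq]] by simp
qed (use assms in blast)

lemma ritz_in_W: "x \<in> V \<Longrightarrow> ritz x \<in> W"
  and ritz_orthogonal: "x \<in> V \<Longrightarrow> v \<in> W \<Longrightarrow> a (x - ritz x) v = 0"
proof -
  have "ritz x \<in> W \<and> (\<forall>v\<in>W. a (x - ritz x) v = 0)" if x: "x \<in> V" for x
  proof -
    obtain B where B: "finite B" "W = span B" using W(3) by blast
    moreover have "B \<subseteq> V" using B W(2) span_superset by blast
    ultimately obtain p where "p \<in> W" "\<forall>v\<in>W. a (x - p) v = 0"
      using orthogonal_projection_exists[of B x] x by blast
    moreover from this have "ritz x = p" by (intro ritz_eqI x) auto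
    ultimately show ?thesis by simp
  qed
  then show "x \<in> V \<Longrightarrow> ritz x \<in> W" "x \<in> V \<Longrightarrow> v \<in> W \<Longrightarrow> a (x - ritz x) v = 0" by blast+
qed

lemma ritz_ident: "x \<in> W \<Longrightarrow> ritz x = x"
  by (rule ritz_eqI) (auto simp: W_V zero_left)

lemma ritz_add:
  assumes "x \<in> V" "y \<in> V" shows "ritz (x + y) = ritz x + ritz y"
proof (rule ritz_eqI)
  fix v assume v: "v \<in> W"
  have "a ((x - ritz x) + (y - ritz y)) v = a (x - ritz x) v + a (y - ritz y) v"
    using assms v by (intro add_left) (auto simp: V_closed ritz_in_W W_V)
  then show "a (x + y - (ritz x + ritz y)) v = 0"
    using assms v by (simp add: ritz_orthogonal add_diff_add)
qed (use assms ritz_in_W in \<open>auto simp: V_closed W_closed\<close>)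

lemma ritz_scale:
  assumes "x \<in> V" shows "ritz (c *\<^sub>R x) = c *\<^sub>R ritz x"
proof (rule ritz_eqI)
  fix v assume v: "v \<in> W"
  have "c *\<^sub>R x - c *\<^sub>R ritz x = c *\<^sub>R (x - ritz x)" by (simp add: scaleR_diff_right)
  then show "a (c *\<^sub>R x - c *\<^sub>R ritz x) v = 0"
    using assms v ritz_in_W W_V ritz_orthogonal by (simp add: scale_left V_closed)
qed (use assms ritz_in_W in \<open>auto simp: V_closed W_closed\<close>)

definition res :: "'v \<Rightarrow> 'v" where "res x = x - ritz x"

lemma res_in_V: "x \<in> V \<Longrightarrow> res x \<in> V"
  by (simp add: res_def V_closed W_V ritz_in_W)

lemma res_add: "x \<in> V \<Longrightarrow> y \<in> V \<Longrightarrow> res (x + y) = res x + res y"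
  by (simp add: res_def ritz_add)

lemma res_scale: "x \<in> V \<Longrightarrow> res (c *\<^sub>R x) = c *\<^sub>R res x"
  by (simp add: res_def ritz_scale scaleR_diff_right)

lemma res_zero: "res 0 = 0"
  by (simp add: res_def ritz_ident W_closed)

lemma res_diff: "x \<in> V \<Longrightarrow> y \<in> V \<Longrightarrow> res (x - y) = res x - res y"
  using res_add[of x "(-1) *\<^sub>R y"] res_scale[of y "-1"] by (simp add: V_closed)

lemma res_sum:
  "finite I \<Longrightarrow> (\<And>i. i \<in> I \<Longrightarrow> x i \<in> V) \<Longrightarrow> res (\<Sum>i\<in>I. x i) = (\<Sum>i\<in>I. res (x i))"
  by (induction I rule: finite_induct) (auto simp: res_zero res_add V_closed)

text \<open>
  The polarization of \<open>E x = \<parallel>x - R x\<parallel>\<^sup>2 + \<parallel>\<nabla>(x - R x)\<parallel>\<^sup>2\<close>.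
\<close>

definition res_form :: "'v \<Rightarrow> 'v \<Rightarrow> real" where
  "res_form x y = inner (res x) (res y) + a (res x) (res y)"

lemma semi_inner_res_form: "semi_inner V res_form"
proof
  show "res_form x y = res_form y x" if "x \<in> V" "y \<in> V" for x y
    using that by (simp add: res_form_def inner_commute commute res_in_V)
  show "res_form (x + y) z = res_form x z + res_form y z" if "x \<in> V" "y \<in> V" "z \<in> V" for x y z
    using that by (simp add: res_form_def res_add inner_add_left add_left res_in_V)
  show "res_form (c *\<^sub>R x) z = c * res_form x z" if "x \<in> V" "z \<in> V" for c x z
    using that by (simp add: res_form_def res_scale scale_left res_in_V distrib_left)
  show "0 \<le> res_form x x" if "x \<in> V" for x
    using that by (simp add: res_form_def nonneg res_in_V)
qed (rule V)

text \<open>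
  Test with the difference quotient \<open>d = (y - x) / dt\<close>. Young's inequality absorbs \<open>\<parallel>d\<parallel>\<^sup>2\<close> and
  leaves \<open>2 \<nu> a(y, d) \<le> \<parallel>\<rho>\<parallel>\<^sup>2\<close>, and \<open>a(x, x) = a(y - dt d, y - dt d) \<ge> a(y, y) - 2 dt a(y, d)\<close>.
\<close>

lemma backward_euler_energy_step:
  assumes "0 < \<nu>" "0 < dt" and x: "x \<in> W" and y: "y \<in> W"
    and eq: "\<And>v. v \<in> W \<Longrightarrow> inner ((y - x) /\<^sub>R dt) v + \<nu> * a y v = inner \<rho> v"
  shows "a y y \<le> a x x + dt / \<nu> * (norm \<rho>)\<^sup>2"
proof -
  define d where "d = (y - x) /\<^sub>R dt"
  have d: "d \<in> W" using x y by (simp add: d_def W_closed)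
  have xd: "x = y - dt *\<^sub>R d" using \<open>0 < dt\<close> by (simp add: d_def)
  have "\<nu> * a y d = inner \<rho> d - (norm d)\<^sup>2"
    using eq[OF d] by (simp add: d_def[symmetric] power2_norm_eq_inner)
  moreover have "2 * inner \<rho> d \<le> (norm \<rho>)\<^sup>2 + (norm d)\<^sup>2"
    using inner_ge_zero[of "\<rho> - d"]
    by (simp add: inner_diff_left inner_diff_right inner_commute power2_norm_eq_inner)
  ultimately have "\<nu> * (2 * a y d) \<le> (norm \<rho>)\<^sup>2" using zero_le_power2[of "norm d"] by linarith
  then have "2 * a y d \<le> (norm \<rho>)\<^sup>2 / \<nu>"
    using \<open>0 < \<nu>\<close> by (simp add: pos_le_divide_eq mult.commute)
  then have 1: "dt * (2 * a y d) \<le> dt * ((norm \<rho>)\<^sup>2 / \<nu>)"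
    using \<open>0 < dt\<close> by (intro mult_left_mono) auto
  have "a x x = a y y - dt * (2 * a y d) + dt\<^sup>2 * a d d"
    using W_V[OF y] W_V[OF d] commute[of y d] unfolding xd
    by (simp add: diff_left diff_right scale_left scale_right V_closed power2_eq_square algebra_simps)
  moreover have "0 \<le> dt\<^sup>2 * a d d" using nonneg W_V d by simp
  ultimately show ?thesis using 1 by simp
qed

text \<open>
  The error is \<open>res (u k) - \<phi> k\<close>, the difference of the projection error and the discrete error
  \<open>\<phi> k = z k - ritz (u k)\<close>. The first is summed up from its increments; the second satisfies a
  backward Euler scheme with right-hand side \<open>res (d n)\<close>, since \<open>res\<close> commutes with difference
  quotients. The factor \<open>dt * (N - 1)\<close> is the length of the time interval.
\<close>

lemma res_error_estimate:
  assumes "0 < \<nu>" "0 < dt" and k: "1 \<le> k" "k \<le> N"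
    and u: "\<And>n. 1 \<le> n \<Longrightarrow> n \<le> N \<Longrightarrow> u n \<in> V" and z: "\<And>n. 1 \<le> n \<Longrightarrow> n \<le> N \<Longrightarrow> z n \<in> W"
    and eq: "\<And>n v. 1 \<le> n \<Longrightarrow> n < N \<Longrightarrow> v \<in> W \<Longrightarrow>
      inner (diff_quot dt u n - diff_quot dt z n) v + \<nu> * a (u (n + 1) - z (n + 1)) v = 0"
  defines "S \<equiv> res_form (u 1) (u 1) + (\<Sum>n=1..<N. dt * res_form (diff_quot dt u n) (diff_quot dt u n))"
  shows "a (u k - z k) (u k - z k)
    \<le> (4 * max 1 (dt * (real N - 1)) + 2 / \<nu> + 2) * (S + a (z 1 - ritz (u 1)) (z 1 - ritz (u 1)))"
proof -
  define d where "d n = diff_quot dt u n" for n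
  define \<phi> where "\<phi> n = z n - ritz (u n)" for n
  define M where "M = max 1 (dt * (real N - 1))"
  have dV: "d n \<in> V" if "1 \<le> n" "n < N" for n
    using that u by (simp add: d_def diff_quot_def V_closed)
  have \<phi>W: "\<phi> n \<in> W" if "1 \<le> n" "n \<le> N" for n
    using that u z by (simp add: \<phi>_def W_closed ritz_in_W)
  have form_nonneg: "0 \<le> res_form x x" if "x \<in> V" for x
    using semi_inner.nonneg[OF semi_inner_res_form that] .
  have form_norm: "(norm (res x))\<^sup>2 \<le> res_form x x" and form_a: "a (res x) (res x) \<le> res_form x x"
    if "x \<in> V" for x
    using that nonneg[OF res_in_V[OF that]] by (auto simp: res_form_def power2_norm_eq_inner)
  have partial: "(\<Sum>n=1..<m. dt * res_form (d n) (d n)) \<le> S - res_form (u 1) (u 1)" if "m \<le> N" for m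
    unfolding S_def d_def[symmetric] add_diff_cancel_left'
    using that \<open>0 < dt\<close> dV by (intro sum_mono2) (auto intro!: mult_nonneg_nonneg form_nonneg)
  have u1: "u 1 \<in> V" "0 \<le> res_form (u 1) (u 1)" using u k form_nonneg by auto
  have S0: "0 \<le> S" using partial[of 1] u1 k by simp
  \<comment> \<open>the projection error, by the Cauchy-Schwarz inequality in time\<close>
  have u_k: "u k = u 1 + (\<Sum>n=1..<k. dt *\<^sub>R d n)"
    using k(1) \<open>0 < dt\<close>
  proof (induction k rule: dec_induct)
    case (step m)
    then show ?case by (simp add: d_def diff_quot_def)
  qed simp
  have "res (u 1 + (\<Sum>n=1..<k. dt *\<^sub>R d n)) = res (u 1) + res (\<Sum>n=1..<k. dt *\<^sub>R d n)"
    using dV k by (intro res_add u1 subspace_sum[OF V]) (auto simp: V_closed)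
  also have "res (\<Sum>n=1..<k. dt *\<^sub>R d n) = (\<Sum>n=1..<k. res (dt *\<^sub>R d n))"
    using dV k by (intro res_sum) (auto simp: V_closed)
  also have "\<dots> = (\<Sum>n=1..<k. dt *\<^sub>R res (d n))"
    using dV k by (intro sum.cong refl res_scale) auto
  finally have "res (u k) = res (u 1) + (\<Sum>n=1..<k. dt *\<^sub>R res (d n))" by (simp only: u_k)
  moreover have "(\<Sum>n=1..<k. dt *\<^sub>R res (d n)) \<in> V"
    using dV k by (intro subspace_sum[OF V]) (auto simp: V_closed res_in_V)
  ultimately have "a (res (u k)) (res (u k)) \<le> 2 * a (res (u 1)) (res (u 1))
      + 2 * a (\<Sum>n=1..<k. dt *\<^sub>R res (d n)) (\<Sum>n=1..<k. dt *\<^sub>R res (d n))"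
    using u1 by (simp add: add_self_le res_in_V)
  also have "a (\<Sum>n=1..<k. dt *\<^sub>R res (d n)) (\<Sum>n=1..<k. dt *\<^sub>R res (d n))
      \<le> card {1..<k} * (\<Sum>n=1..<k. a (dt *\<^sub>R res (d n)) (dt *\<^sub>R res (d n)))"
    using dV k by (intro sum_self_le) (auto simp: V_closed res_in_V)
  also have "\<dots> = (dt * real (k - 1)) * (\<Sum>n=1..<k. dt * a (res (d n)) (res (d n)))"
    using dV k by (simp add: sum_distrib_left scale_left scale_right res_in_V V_closed algebra_simps)
  also have "\<dots> \<le> M * (\<Sum>n=1..<k. dt * res_form (d n) (d n))"
  proof (rule mult_mono)
    have "dt * real (k - 1) \<le> dt * (real N - 1)" using k \<open>0 < dt\<close> by simp
    then show "dt * real (k - 1) \<le> M" by (simp add: M_def)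
    show "(\<Sum>n=1..<k. dt * a (res (d n)) (res (d n))) \<le> (\<Sum>n=1..<k. dt * res_form (d n) (d n))"
      using dV k \<open>0 < dt\<close> by (intro sum_mono mult_left_mono form_a) auto
    show "0 \<le> (\<Sum>n=1..<k. dt * a (res (d n)) (res (d n)))"
      using dV k \<open>0 < dt\<close> by (intro sum_nonneg mult_nonneg_nonneg nonneg res_in_V) auto
  qed (simp add: M_def)
  also have "\<dots> \<le> M * (S - res_form (u 1) (u 1))"
    using partial[OF k(2)] by (intro mult_left_mono) (auto simp: M_def)
  finally have "a (res (u k)) (res (u k)) \<le> 2 * a (res (u 1)) (res (u 1)) + 2 * (M * (S - res_form (u 1) (u 1)))"
    by simp
  also have "\<dots> \<le> 2 * (M * res_form (u 1) (u 1)) + 2 * (M * (S - res_form (u 1) (u 1)))"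
    using form_a[OF u1(1)] mult_right_mono[of 1 M "res_form (u 1) (u 1)"] u1(2) by (simp add: M_def)
  also have "\<dots> = 2 * M * S" by (simp add: algebra_simps)
  finally have proj: "a (res (u k)) (res (u k)) \<le> 2 * M * S" .
  \<comment> \<open>the discrete error: the difference quotient of \<open>\<phi>\<close> is that of \<open>res u\<close> minus that of \<open>u - z\<close>,
    and the terms in \<open>u - z\<close> cancel by the error equation\<close>
  have energy: "a (\<phi> (n + 1)) (\<phi> (n + 1)) \<le> a (\<phi> n) (\<phi> n) + dt / \<nu> * (norm (res (d n)))\<^sup>2"
    if n: "1 \<le> n" "n < N" for n
  proof (rule backward_euler_energy_step[OF assms(1,2)])
    show "\<phi> n \<in> W" "\<phi> (n + 1) \<in> W" using \<phi>W n by auto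
    fix v assume v: "v \<in> W"
    have un: "u n \<in> V" "u (n + 1) \<in> V" and zn: "z (n + 1) \<in> V" using u z W_V n by auto
    have "res (d n) = (res (u (n + 1)) - res (u n)) /\<^sub>R dt"
      using un by (simp add: d_def diff_quot_def res_scale res_diff V_closed)
    then have "(\<phi> (n + 1) - \<phi> n) /\<^sub>R dt = res (d n) - (diff_quot dt u n - diff_quot dt z n)"
      by (simp add: \<phi>_def res_def diff_quot_def algebra_simps)
    moreover have "a (\<phi> (n + 1)) v = - a (u (n + 1) - z (n + 1)) v"
    proof -
      have "\<phi> (n + 1) = res (u (n + 1)) - (u (n + 1) - z (n + 1))"
        by (simp add: \<phi>_def res_def)
      then have "a (\<phi> (n + 1)) v = a (res (u (n + 1))) v - a (u (n + 1) - z (n + 1)) v"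
        using un zn W_V[OF v] diff_left[of "res (u (n + 1))" "u (n + 1) - z (n + 1)" v]
        by (simp add: res_in_V V_closed)
      moreover have "a (res (u (n + 1))) v = 0" using un v by (simp add: res_def ritz_orthogonal)
      ultimately show ?thesis by simp
    qed
    ultimately show "inner ((\<phi> (n + 1) - \<phi> n) /\<^sub>R dt) v + \<nu> * a (\<phi> (n + 1)) v = inner (res (d n)) v"
      using eq[OF n v] by (simp add: inner_diff_left)
  qed
  have "a (\<phi> k) (\<phi> k) \<le> a (\<phi> 1) (\<phi> 1) + (\<Sum>n=1..<k. dt / \<nu> * (norm (res (d n)))\<^sup>2)"
    using k
  proof (induction k rule: dec_induct)
    case (step m)
    then show ?case using energy[of m] by simp
  qed simp
  also have "(\<Sum>n=1..<k. dt / \<nu> * (norm (res (d n)))\<^sup>2) \<le> (\<Sum>n=1..<k. dt / \<nu> * res_form (d n) (d n))"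
    using dV k \<open>0 < dt\<close> \<open>0 < \<nu>\<close> by (intro sum_mono mult_left_mono form_norm) auto
  also have "\<dots> = (\<Sum>n=1..<k. dt * res_form (d n) (d n)) / \<nu>"
    by (simp add: sum_divide_distrib)
  also have "\<dots> \<le> S / \<nu>"
    using partial[OF k(2)] u1(2) \<open>0 < \<nu>\<close> by (intro divide_right_mono) auto
  finally have disc: "a (\<phi> k) (\<phi> k) \<le> a (\<phi> 1) (\<phi> 1) + S / \<nu>" by simp
  \<comment> \<open>squaring a difference costs a factor \<open>2\<close>, which gives \<open>S\<close> the coefficient
    \<open>4 * M + 2 / \<nu>\<close> and the initial value the coefficient \<open>2\<close>; their sum serves for both\<close>
  have "u k - z k = res (u k) - \<phi> k" by (simp add: res_def \<phi>_def)
  then have "a (u k - z k) (u k - z k) \<le> 2 * a (res (u k)) (res (u k)) + 2 * a (\<phi> k) (\<phi> k)"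
    using diff_self_le[of "res (u k)" "\<phi> k"] res_in_V u \<phi>W W_V k by simp
  also have "\<dots> \<le> 4 * M * S + 2 * a (\<phi> 1) (\<phi> 1) + 2 / \<nu> * S" using proj disc by simp
  also have "\<dots> \<le> (4 * M + 2 / \<nu> + 2) * (S + a (\<phi> 1) (\<phi> 1))"
  proof -
    have "0 \<le> a (\<phi> 1) (\<phi> 1)" using nonneg[OF W_V[OF \<phi>W]] k by simp
    moreover have "0 \<le> M" "0 \<le> 2 / \<nu>" using \<open>0 < \<nu>\<close> by (auto simp: M_def)
    ultimately have "0 \<le> 2 * S" "0 \<le> (4 * M + 2 / \<nu>) * a (\<phi> 1) (\<phi> 1)" using S0 by auto
    then show ?thesis by (simp add: algebra_simps)
  qed
  finally show ?thesis by (simp add: M_def \<phi>_def)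
qed

end


section \<open>Proper orthogonal decomposition\<close>

text \<open>
  The positive terms of a nonincreasing sequence form an initial segment, so that summing up to the
  number of positive eigenvalues covers all of them.
\<close>

lemma positive_indices_eq:
  assumes "\<And>i j. 1 \<le> i \<Longrightarrow> i \<le> j \<Longrightarrow> j \<le> N \<Longrightarrow> lam j \<le> lam i"
  shows "{i \<in> {1..N}. 0 < lam i} = {1..num_pos N lam}"
proof -
  define P where "P = {i \<in> {1..N}. 0 < lam i}"
  define m where "m = Max (insert 0 P)"
  have fin: "finite P" by (simp add: P_def)
  have "P = {1..m}"
  proof (intro equalityI subsetI)
    show "i \<in> {1..m}" if "i \<in> P" for i
      using that fin by (auto simp: m_def P_def)
    fix i assume i: "i \<in> {1..m}"
    have "m \<in> insert 0 P" unfolding m_def using fin by (intro Max_in) auto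
    with i have "1 \<le> i" "i \<le> m" "m \<le> N" "0 < lam m" by (auto simp: P_def)
    with assms[of i m] show "i \<in> P" by (simp add: P_def)
  qed
  moreover from this have "num_pos N lam = m" unfolding num_pos_def P_def[symmetric] by simp
  ultimately show ?thesis by (simp add: P_def)
qed

lemma sum_split_first:
  assumes "1 \<le> (N::nat)"
  shows "(\<Sum>j=1..N. h j) = h 1 + (\<Sum>j=1..<N. h (j + 1))"
proof -
  have "(\<Sum>j=1..N. h j) = h 1 + (\<Sum>j=Suc 1..N. h j)"
    using assms by (rule sum.atLeast_Suc_atMost)
  also have "{Suc 1..N} = {Suc 1..<Suc N}" by auto
  also have "(\<Sum>j=Suc 1..<Suc N. h j) = (\<Sum>j=1..<N. h (Suc j))"
    by (rule sum.shift_bounds_Suc_ivl)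
  finally show ?thesis by simp
qed

text \<open>
  The data \<open>x\<^sub>1 = u\<^sup>1\<close> and \<open>x\<^sub>j = \<partial>u\<^sup>j\<^sup>-\<^sup>1\<close> for \<open>j \<ge> 2\<close>, with the weights of the inner product of \<open>S\<close>,
  turn \<open>K1\<close> into a single weighted sum. Basis independence then replaces the sum over the data by a
  sum over the vectors \<open>K1 f\<^sub>i = sqrt \<lambda>\<^sub>i \<phi>\<^sub>i\<close>. A mode with positive eigenvalue is a multiple of
  \<open>K1 f\<^sub>i\<close>, hence a combination of the data, and lies in \<open>V\<close>.
\<close>

lemma pod_energy_identity:
  assumes form: "semi_inner V F" and N: "1 \<le> N" and "0 < dt"
    and u: "\<And>n. 1 \<le> n \<Longrightarrow> n \<le> N \<Longrightarrow> u n \<in> V"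
    and svd: "is_pod_svd \<Omega> dt N u lam fs M \<phi>"
  shows "F (u 1) (u 1) + (\<Sum>n=1..<N. dt * F (diff_quot dt u n) (diff_quot dt u n))
      = (\<Sum>i=1..num_pos N lam. lam i * F (\<phi> i) (\<phi> i))"
    and "\<And>i. i \<in> {1..num_pos N lam} \<Longrightarrow> \<phi> i \<in> V"
proof -
  interpret semi_inner V F by fact
  define x where "x j = (if j = 1 then u 1 else diff_quot dt u (j - 1))" for j
  define w where "w j = (if j = 1 then 1 else dt)" for j :: nat
  have xV: "x j \<in> V" if "j \<in> {1..N}" for j
    using that N u by (auto simp: x_def diff_quot_def intro!: V_closed)
  have lam: "0 \<le> lam i" and K: "K1 dt N u (fs i) = sqrt (lam i) *\<^sub>R \<phi> i" if "i \<in> {1..N}" for i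
    using svd that unfolding is_pod_svd_def by blast+
  have pos: "{i \<in> {1..N}. 0 < lam i} = {1..num_pos N lam}"
    using svd by (intro positive_indices_eq) (auto simp: is_pod_svd_def)
  have K_sum: "K1 dt N u g = (\<Sum>j=1..N. (w j * g j) *\<^sub>R x j)" for g
  proof -
    have "{1..N - 1} = {1..<N}" by auto
    then show ?thesis unfolding sum_split_first[OF N] by (simp add: K1_def w_def x_def)
  qed
  have S_sum: "S_inner dt N g h = (\<Sum>j=1..N. w j * (g j * h j))" for g h
  proof -
    have "(\<Sum>j=1..N. w j * (g j * h j)) = w 1 * (g 1 * h 1) + (\<Sum>j=Suc 1..N. w j * (g j * h j))"
      using N by (rule sum.atLeast_Suc_atMost)
    also have "(\<Sum>j=Suc 1..N. w j * (g j * h j)) = (\<Sum>j=2..N. dt * (g j * h j))"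
      by (intro sum.cong) (auto simp: w_def)
    finally show ?thesis by (simp add: S_inner_def w_def sum_distrib_left)
  qed
  have KV: "sqrt (lam i) *\<^sub>R \<phi> i \<in> V" if "i \<in> {1..N}" for i
    unfolding K[OF that, symmetric] K_sum by (intro subspace_sum[OF V] subspace_scale[OF V] xV)
  have \<phi>V: "\<phi> i \<in> V" if i: "i \<in> {1..num_pos N lam}" for i
  proof -
    have "i \<in> {1..N}" "0 < lam i" using i pos by blast+
    with subspace_scale[OF V KV, of i "1 / sqrt (lam i)"] show ?thesis by simp
  qed
  then show "\<And>i. i \<in> {1..num_pos N lam} \<Longrightarrow> \<phi> i \<in> V" .
  have "F (u 1) (u 1) + (\<Sum>n=1..<N. dt * F (diff_quot dt u n) (diff_quot dt u n))
      = (\<Sum>j=1..N. w j * F (x j) (x j))"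
    unfolding sum_split_first[OF N] by (simp add: w_def x_def)
  also have "\<dots> = (\<Sum>i=1..N. F (\<Sum>j=1..N. (w j * fs i j) *\<^sub>R x j) (\<Sum>j=1..N. (w j * fs i j) *\<^sub>R x j))"
  proof (rule sum_self_orthonormal[symmetric])
    show "0 < w j" for j using \<open>0 < dt\<close> by (simp add: w_def)
    show "(\<Sum>j=1..N. w j * (fs i j * fs l j)) = (if i = l then 1 else 0)"
      if "i \<in> {1..N}" "l \<in> {1..N}" for i l
      using svd that unfolding S_sum[symmetric] is_pod_svd_def by blast
  qed (use xV in auto)
  also have "\<dots> = (\<Sum>i=1..N. F (sqrt (lam i) *\<^sub>R \<phi> i) (sqrt (lam i) *\<^sub>R \<phi> i))"
    unfolding K_sum[symmetric] by (intro sum.cong refl) (simp only: K)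
  also have "\<dots> = (\<Sum>i\<in>{i \<in> {1..N}. 0 < lam i}. F (sqrt (lam i) *\<^sub>R \<phi> i) (sqrt (lam i) *\<^sub>R \<phi> i))"
  proof (intro sum.mono_neutral_right ballI)
    fix i assume i: "i \<in> {1..N} - {i \<in> {1..N}. 0 < lam i}"
    then have "lam i = 0" using lam[of i] by force
    then show "F (sqrt (lam i) *\<^sub>R \<phi> i) (sqrt (lam i) *\<^sub>R \<phi> i) = 0"
      by (simp add: zero_left V_closed)
  qed auto
  also have "\<dots> = (\<Sum>i=1..num_pos N lam. lam i * F (\<phi> i) (\<phi> i))"
    unfolding pos
  proof (intro sum.cong refl)
    fix i assume i: "i \<in> {1..num_pos N lam}"
    then have "i \<in> {1..N}" using pos by blast
    with lam[OF this] \<phi>V[OF i] show "F (sqrt (lam i) *\<^sub>R \<phi> i) (sqrt (lam i) *\<^sub>R \<phi> i) = lam i * F (\<phi> i) (\<phi> i)"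
      by (simp add: scale_left scale_right V_closed flip: mult.assoc)
  qed
  finally show "F (u 1) (u 1) + (\<Sum>n=1..<N. dt * F (diff_quot dt u n) (diff_quot dt u n))
      = (\<Sum>i=1..num_pos N lam. lam i * F (\<phi> i) (\<phi> i))" .
qed

theorem theorem4p3:
  fixes \<Omega> :: "'a::euclidean_space set"
    and \<nu> T :: real
    and f :: "real \<Rightarrow> 'a L2"
  assumes "bounded_lipschitz_domain \<Omega>"
    and "\<nu> > 0"
    and "T > 0"
    and "\<forall>t\<in>{0..T}. f t \<in> L2_on \<Omega>"
  shows "\<exists>C>0. \<forall>(Vh :: 'a L2 set) (N::nat) (u :: nat \<Rightarrow> 'a L2)
      (lam :: nat \<Rightarrow> real) (fs :: nat \<Rightarrow> nat \<Rightarrow> real) (M::nat) (\<phi> :: nat \<Rightarrow> 'a L2)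
      (r::nat) (Vr :: 'a L2 set) (ur :: nat \<Rightarrow> 'a L2).
    fe_space \<Omega> Vh \<and> 2 \<le> N \<and>
    backward_euler \<Omega> \<nu> f T N Vh u \<and>
    is_pod_svd \<Omega> (time_step T N) N u lam fs M \<phi> \<and>
    1 \<le> r \<and> r \<le> M \<and> (\<forall>i\<in>{1..r}. \<phi> i \<in> Vh) \<and>
    Vr = span (\<phi> ` {1..r}) \<and>
    ur 1 = L2_proj Vr (u 1) \<and>
    backward_euler \<Omega> \<nu> f T N Vr ur
    \<longrightarrow>
    (MAX k\<in>{1..N}. (grad_norm \<Omega> (u k - ur k))\<^sup>2)
      \<le> C * ((\<Sum>i=r+1..num_pos N lam.
                lam i * ((norm (\<phi> i - ritz_proj \<Omega> Vr (\<phi> i)))\<^sup>2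
                        + (grad_norm \<Omega> (\<phi> i - ritz_proj \<Omega> Vr (\<phi> i)))\<^sup>2))
             + (grad_norm \<Omega> (ur 1 - ritz_proj \<Omega> Vr (u 1)))\<^sup>2)"
proof (intro exI[of _ "4 * max 1 T + 2 / \<nu> + 2"] conjI allI impI)
  show "0 < 4 * max 1 T + 2 / \<nu> + 2" using assms by (simp add: add_pos_pos)
  fix Vh N u lam fs M \<phi> r Vr ur
  assume *: "fe_space \<Omega> Vh \<and> 2 \<le> N \<and>
    backward_euler \<Omega> \<nu> f T N Vh u \<and>
    is_pod_svd \<Omega> (time_step T N) N u lam fs M \<phi> \<and>
    1 \<le> r \<and> r \<le> M \<and> (\<forall>i\<in>{1..r}. \<phi> i \<in> Vh) \<and>
    Vr = span (\<phi> ` {1..r}) \<and>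
    ur 1 = L2_proj Vr (u 1) \<and>
    backward_euler \<Omega> \<nu> f T N Vr ur"
  then have fe: "fe_space \<Omega> Vh" and N: "2 \<le> N" and be: "backward_euler \<Omega> \<nu> f T N Vh u"
    and svd: "is_pod_svd \<Omega> (time_step T N) N u lam fs M \<phi>" and \<phi>: "\<forall>i\<in>{1..r}. \<phi> i \<in> Vh"
    and Vr: "Vr = span (\<phi> ` {1..r})" and ber: "backward_euler \<Omega> \<nu> f T N Vr ur"
    by blast+
  define dt where "dt = time_step T N"
  have dt: "0 < dt" "dt * (real N - 1) = T" using N \<open>T > 0\<close> by (auto simp: dt_def time_step_def)
  have \<Omega>: "open \<Omega>" "bounded \<Omega>" using assms(1) by (auto simp: bounded_lipschitz_domain_def)
  have Vh: "subspace Vh" "Vh \<subseteq> H01 \<Omega>" using fe by (auto simp: fe_space_def)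
  then have H1: "x \<in> H1 \<Omega>" if "x \<in> Vh" for x using that unfolding H01_def by blast
  interpret galerkin_space Vh "grad_inner \<Omega>" Vr
  proof
    show "grad_inner \<Omega> x y = grad_inner \<Omega> y x" for x y by (rule grad_inner_commute)
    show "grad_inner \<Omega> (x + y) z = grad_inner \<Omega> x z + grad_inner \<Omega> y z" if "x \<in> Vh" "y \<in> Vh" for x y z
      using that by (intro grad_inner_add_left \<Omega> H1)
    show "grad_inner \<Omega> (c *\<^sub>R x) z = c * grad_inner \<Omega> x z" if "x \<in> Vh" for c x z
      using that by (intro grad_inner_scaleR_left \<Omega> H1)
    show "x = 0" if "x \<in> Vh" "grad_inner \<Omega> x x = 0" for x
      using that Vh by (intro grad_inner_definite[OF \<Omega>]) auto
    show "Vr \<subseteq> Vh" unfolding Vr using \<phi> by (intro span_minimal Vh) auto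
    show "\<exists>B. finite B \<and> Vr = span B" unfolding Vr by blast
  qed (auto simp: Vh grad_inner_self_nonneg Vr)
  have ritz_eq: "ritz_proj \<Omega> Vr = ritz" by (simp add: fun_eq_iff ritz_proj_def ritz_def)
  have grad_norm_sq: "(grad_norm \<Omega> x)\<^sup>2 = grad_inner \<Omega> x x" for x
    by (simp add: grad_norm_def grad_inner_self_nonneg)
  have u: "u n \<in> Vh" and ur: "ur n \<in> Vr" if "1 \<le> n" "n \<le> N" for n
    using be ber that by (auto simp: backward_euler_def)
  have eq: "inner (diff_quot dt u n - diff_quot dt ur n) v + \<nu> * grad_inner \<Omega> (u (n + 1) - ur (n + 1)) v = 0"
    if n: "1 \<le> n" "n < N" and v: "v \<in> Vr" for n v
  proof -
    have "n \<in> {1..N - 1}" using n by auto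
    then have "inner (diff_quot dt u n) v + \<nu> * grad_inner \<Omega> (u (n + 1)) v
        = inner (diff_quot dt ur n) v + \<nu> * grad_inner \<Omega> (ur (n + 1)) v"
      using be ber v W_V[OF v] unfolding backward_euler_def dt_def by simp
    moreover have "grad_inner \<Omega> (u (n + 1) - ur (n + 1)) v = grad_inner \<Omega> (u (n + 1)) v - grad_inner \<Omega> (ur (n + 1)) v"
      using n v by (intro diff_left u W_V ur) auto
    ultimately show ?thesis by (simp add: inner_diff_left right_diff_distrib)
  qed
  note identity = pod_energy_identity[OF semi_inner_res_form _ dt(1) u svd[folded dt_def]]
  have "res_form (u 1) (u 1) + (\<Sum>n=1..<N. dt * res_form (diff_quot dt u n) (diff_quot dt u n))
      = (\<Sum>i=1..num_pos N lam. lam i * res_form (\<phi> i) (\<phi> i))"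
    using N by (intro identity(1)) auto
  also have "\<dots> = (\<Sum>i=r+1..num_pos N lam. lam i * res_form (\<phi> i) (\<phi> i))"
  proof (intro sum.mono_neutral_right ballI)
    \<comment> \<open>the first \<open>r\<close> modes span the POD space and equal their own Ritz projections\<close>
    fix i assume "i \<in> {1..num_pos N lam} - {r+1..num_pos N lam}"
    then have "\<phi> i \<in> Vr" unfolding Vr by (intro span_base) auto
    then show "lam i * res_form (\<phi> i) (\<phi> i) = 0"
      by (simp add: res_form_def res_def ritz_ident zero_left V_closed)
  qed auto
  finally have S: "res_form (u 1) (u 1) + (\<Sum>n=1..<N. dt * res_form (diff_quot dt u n) (diff_quot dt u n))
      = (\<Sum>i=r+1..num_pos N lam. lam i * ((norm (\<phi> i - ritz_proj \<Omega> Vr (\<phi> i)))\<^sup>2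
          + (grad_norm \<Omega> (\<phi> i - ritz_proj \<Omega> Vr (\<phi> i)))\<^sup>2))"
    by (simp add: res_form_def res_def ritz_eq grad_norm_sq power2_norm_eq_inner)
  show "(MAX k\<in>{1..N}. (grad_norm \<Omega> (u k - ur k))\<^sup>2)
      \<le> (4 * max 1 T + 2 / \<nu> + 2) * ((\<Sum>i=r+1..num_pos N lam.
                lam i * ((norm (\<phi> i - ritz_proj \<Omega> Vr (\<phi> i)))\<^sup>2
                        + (grad_norm \<Omega> (\<phi> i - ritz_proj \<Omega> Vr (\<phi> i)))\<^sup>2))
             + (grad_norm \<Omega> (ur 1 - ritz_proj \<Omega> Vr (u 1)))\<^sup>2)"
  proof (rule Max.boundedI)
    fix b assume "b \<in> (\<lambda>k. (grad_norm \<Omega> (u k - ur k))\<^sup>2) ` {1..N}"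
    then obtain k where k: "1 \<le> k" "k \<le> N" and b: "b = grad_inner \<Omega> (u k - ur k) (u k - ur k)"
      by (auto simp: grad_norm_sq)
    show "b \<le> (4 * max 1 T + 2 / \<nu> + 2) * ((\<Sum>i=r+1..num_pos N lam.
                lam i * ((norm (\<phi> i - ritz_proj \<Omega> Vr (\<phi> i)))\<^sup>2
                        + (grad_norm \<Omega> (\<phi> i - ritz_proj \<Omega> Vr (\<phi> i)))\<^sup>2))
             + (grad_norm \<Omega> (ur 1 - ritz_proj \<Omega> Vr (u 1)))\<^sup>2)"
      using res_error_estimate[OF \<open>\<nu> > 0\<close> dt(1) k u ur eq] b
      unfolding dt(2) S grad_norm_sq[of "ur 1 - _"] ritz_eq by blast
  qed (use N in auto)
qed

end
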